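(* Let $K$ be a number field with ring of integers $\mathcal{O}_K$, $D=[K:\mathbb{Q}]$, $\mathcal{B}=\{b_1,\dots,b_D\}$ an integral basis of $\mathcal{O}_K$, and $C>0$. There is a constant $C_1=C_1(C,\mathcal{B})>0$, and for every finite nonempty collection $\mathcal{P}$ of $C$-regular prime elements of $\mathcal{O}_K$ whose norms $N_K(p)$, $p\in\mathcal{P}$, are pairwise coprime in $\mathbb{Z}$, there is a function $\rho=\rho_{C,\mathcal{B},\mathcal{P}}\colon\mathbb{N}\to\mathbb{R}_{\ge 0}$ with $\lim_{N\to\infty}\rho(N)=0$, such that the following holds for every $\chi\in\mathcal{M}_K$, every $h\colon\mathbb{Z}^D\to\mathbb{C}$ of modulus at most $1$ and every $N\in\mathbb{N}$: setting $$S(N)=\sum_{\mathbf{n}\in R_{N,D}}\chi(\iota_{\mathcal{B}}(\mathbf{n}))h(\mathbf{n}),\qquad C_{\mathcal{P}}(N)=\sum_{p,q\in\mathcal{P},\,p\ne q}\Big|\sum_{\substack{\mathbf{n}\in\mathbb{Z}^D\\ \mathbf{n}A_{\mathcal{B}}(p),\,\mathbf{n}A_{\mathcal{B}}(q)\in R_{N,D}}}h(\mathbf{n}A_{\mathcal{B}}(p))\overline{h}(\mathbf{n}A_{\mathcal{B}}(q))\Big|,$$ one has $$\Big|\frac{S(N)}{(2N+1)^D}\Big|^2\le C_1\Big(\frac{1}{\mathcal{A}_{\mathcal{P}}^2}\cdot\frac{C_{\mathcal{P}}(N)}{(2N+1)^D}+\frac{1}{\mathcal{A}_{\mathcal{P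}}}+\frac{1}{\mathcal{A}_{\mathcal{P}}^2}\Big)+\rho(N).$$
   Context: For $x\in K$, $A_{\mathcal{B}}(x)\in M_{D\times D}(\mathbb{Q})$ is the matrix with $(xb_1,\dots,xb_D)^T=A_{\mathcal{B}}(x)(b_1,\dots,b_D)^T$ and $N_K(x)=\det A_{\mathcal{B}}(x)$ is the field norm. Vectors are row vectors. $\iota_{\mathcal{B}}(n_1,\dots,n_D)=n_1b_1+\dots+n_Db_D$. For real $x\ge0$, $R_{x,D}=\{\mathbf{n}\in\mathbb{Z}^D:|n_i|\le x\ \forall i\}$ and $R_{x,\mathcal{B}}=\iota_{\mathcal{B}}(R_{x,D})$. $a\in\mathcal{O}_K\setminus\{0\}$ is $C$-regular if $\{z\in\mathcal{O}_K:az\in R_{N,\mathcal{B}}\}\subseteq R_{C|N_K(a)|^{-1/D}N,\mathcal{B}}$ for all $N\in\mathbb{N}$. A prime element is $p\in\mathcal{O}_K \setminus\{0\}$ such that $(p)$ is a prime ideal. $\mathcal{A}_{\mathcal{P}}=\sum_{p\in\mathcal{P}}\frac{1}{|N_K(p)|}$. $\mathcal{M}_K$ is the set of functions $\chi\colon\mathcal{O}_K\to\mathbb{C}$ of modulus at most $1$ with $\chi(mn)=\chi(m)\chi(n)$ whenever $N_K(m),N_K(n)$ are coprime in $\mathbb{Z}$. *)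

theory Defs
  imports "HOL-Analysis.Analysis" "HOL-Algebra.Ideal"
begin

(* A number field is a type 'k :: field_char_0 that is finite-dimensional over rat.  The rational
   numbers act on it through of_rat, the integers through of_int. *)

definition rat_scale :: "rat \<Rightarrow> 'k::field_char_0 \<Rightarrow> 'k" where
  "rat_scale q x = of_rat q * x"

definition int_scale :: "int \<Rightarrow> 'k::field_char_0 \<Rightarrow> 'k" where
  "int_scale m x = of_int m * x"

definition number_field :: "'k::field_char_0 itself \<Rightarrow> bool" where
  "number_field _ \<longleftrightarrow>
     (\<exists>B :: 'k set. finite_dimensional_vector_space (rat_scale :: rat \<Rightarrow> 'k \<Rightarrow> 'k) B)"

definition field_degree :: "'k::field_char_0 itself \<Rightarrow> nat" where
  "field_degree _ = vector_space.dim (rat_scale :: rat \<Rightarrow> 'k \<Rightarrow> 'k) UNIV"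

definition ring_of_integers :: "'k::field_char_0 set" where
  "ring_of_integers = {x. algebraic_int x}"

definition integer_ring :: "'k::field_char_0 ring" where
  "integer_ring = \<lparr>carrier = ring_of_integers, mult = (*), one = 1, zero = 0, add = (+)\<rparr>"

definition integral_basis :: "('d::finite \<Rightarrow> 'k::field_char_0) \<Rightarrow> bool" where
  "integral_basis b \<longleftrightarrow> inj b \<and> \<not> module.dependent int_scale (range b) \<and>
     module.span int_scale (range b) = ring_of_integers"

(* Row convention: (x * b_1, ..., x * b_D)^T = A (b_1, ..., b_D)^T.  For an integral basis of a
   number field, such an A exists and is unique. *)
definition mult_matrix :: "('d::finite \<Rightarrow> 'k::field_char_0) \<Rightarrow> 'k \<Rightarrow> rat^'d^'d" where
  "mult_matrix b x = (THE A. \<forall>i. x * b i = (\<Sum>j\<in>UNIV. of_rat (A $ i $ j) * b j))"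

definition field_norm :: "('d::finite \<Rightarrow> 'k::field_char_0) \<Rightarrow> 'k \<Rightarrow> rat" where
  "field_norm b x = det (mult_matrix b x)"

(* Norms of algebraic integers are integers, but they have type rat, on which
   coprime would not mean coprimality of integers. *)
definition coprime_in_Z :: "rat \<Rightarrow> rat \<Rightarrow> bool" where
  "coprime_in_Z x y \<longleftrightarrow> (\<exists>k l :: int. x = of_int k \<and> y = of_int l \<and> coprime k l)"

(* Z^D is the set of integral vectors in rat^'d, so that n v* mult_matrix b x makes sense without
   a conversion. *)
definition int_lattice :: "(rat^'d::finite) set" where
  "int_lattice = {n. \<forall>i. n $ i \<in> \<int>}"

definition lattice_embed :: "('d::finite \<Rightarrow> 'k::field_char_0) \<Rightarrow> rat^'d \<Rightarrow> 'k" where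
  "lattice_embed b n = (\<Sum>i\<in>UNIV. of_rat (n $ i) * b i)"

definition lattice_box :: "real \<Rightarrow> (rat^'d::finite) set" where
  "lattice_box x = {n \<in> int_lattice. \<forall>i. real_of_rat \<bar>n $ i\<bar> \<le> x}"

definition field_box :: "real \<Rightarrow> ('d::finite \<Rightarrow> 'k::field_char_0) \<Rightarrow> 'k set" where
  "field_box x b = lattice_embed b ` lattice_box x"

definition regular_element :: "real \<Rightarrow> ('d::finite \<Rightarrow> 'k::field_char_0) \<Rightarrow> 'k \<Rightarrow> bool" where
  "regular_element C b a \<longleftrightarrow> a \<in> ring_of_integers - {0} \<and>
     (\<forall>N::nat. {z \<in> ring_of_integers. a * z \<in> field_box (real N) b}
        \<subseteq> field_box (C * real_of_rat \<bar>field_norm b a\<bar> powr (- 1 / real CARD('d)) * real N) b)"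

definition prime_elt :: "'k::field_char_0 \<Rightarrow> bool" where
  "prime_elt p \<longleftrightarrow> p \<in> ring_of_integers - {0} \<and>
     primeideal (cgenideal integer_ring p) integer_ring"

definition inverse_norm_sum :: "('d::finite \<Rightarrow> 'k::field_char_0) \<Rightarrow> 'k set \<Rightarrow> real" where
  "inverse_norm_sum b P = (\<Sum>p\<in>P. 1 / real_of_rat \<bar>field_norm b p\<bar>)"

(* Functions on the ring of integers are total functions on 'k, constrained only on the ring of
   integers. *)
definition multiplicative_funs ::
  "('d::finite \<Rightarrow> 'k::field_char_0) \<Rightarrow> ('k \<Rightarrow> complex) set" where
  "multiplicative_funs b = {f.
     (\<forall>m\<in>ring_of_integers. norm (f m) \<le> 1) \<and>
     (\<forall>m\<in>ring_of_integers. \<forall>n\<in>ring_of_integers.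
        coprime_in_Z (field_norm b m) (field_norm b n) \<longrightarrow> f (m * n) = f m * f n)}"

definition twisted_sum ::
  "('d::finite \<Rightarrow> 'k::field_char_0) \<Rightarrow> ('k \<Rightarrow> complex) \<Rightarrow> (rat^'d \<Rightarrow> complex) \<Rightarrow> nat \<Rightarrow> complex" where
  "twisted_sum b f h N = (\<Sum>n\<in>lattice_box (real N). f (lattice_embed b n) * h n)"

(* The inner index set is finite for nonzero p and q, because mult_matrix b p is then invertible. *)
definition correlation_sum ::
  "('d::finite \<Rightarrow> 'k::field_char_0) \<Rightarrow> 'k set \<Rightarrow> (rat^'d \<Rightarrow> complex) \<Rightarrow> nat \<Rightarrow> real" where
  "correlation_sum b P h N =
     (\<Sum>(p, q) \<in> {(p, q). p \<in> P \<and> q \<in> P \<and> p \<noteq> q}.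
        norm (\<Sum>n\<in>{n \<in> int_lattice. n v* mult_matrix b p \<in> lattice_box (real N) \<and>
                                    n v* mult_matrix b q \<in> lattice_box (real N)}.
                h (n v* mult_matrix b p) * cnj (h (n v* mult_matrix b q))))"

end

theory Submission
  imports Defs "HOL-Real_Asymp.Real_Asymp"
begin

text \<open>
  The proof is Katai's orthogonality argument. Let \<open>A\<close> be the sum of \<open>1 / \<bar>N(p)\<bar>\<close> over \<open>P\<close>, let
  \<open>\<omega>(z)\<close> count the \<open>p \<in> P\<close> that divide \<open>z\<close>, and let \<open>D\<close> be the degree. Three steps, each at the cost of
  an average over the box, lead from \<open>A * S(N)\<close> to correlations of \<open>h\<close>.

    \<^item> \<open>\<omega>\<close> is close to \<open>A\<close> in mean square: its variance over the box tends to at most \<open>A\<close>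
      (Turan--Kubilius, lemma \<open>turan_kubilius\<close>). Hence \<open>A * S(N)\<close> may be replaced by the sum of
      \<open>\<chi>(z) h(z) \<omega>(z)\<close>, which is the sum of \<open>\<chi>(p w) h(p w)\<close> over the pairs \<open>(p, w)\<close>.

    \<^item> \<open>\<chi>(p w) = \<chi>(p) \<chi>(w)\<close> unless some rational prime \<open>l\<close> dividing \<open>N(p)\<close> divides \<open>N(w)\<close>. Along the
      line \<open>w + t\<close> the norm is a monic polynomial in \<open>t\<close> of degree \<open>D\<close>, so at most \<open>D\<close> out of \<open>l\<close>
      values of \<open>t\<close> are bad, and the bad pairs have density at most \<open>D / (l * \<bar>N(p)\<bar>) \<le> D / l\<^sup>2\<close>. As the
      norms are pairwise coprime, each \<open>l\<close> belongs to only one \<open>p\<close>, and the total is at most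
      \<open>D * (\<Sum>l. 1 / l\<^sup>2)\<close> (lemma \<open>noncoprime_quotients_density\<close>). This gives the term \<open>1 / A\<^sup>2\<close>.

    \<^item> In the remaining sum of \<open>\<chi>(w)\<close> times \<open>\<Sum>p. \<chi>(p) h(p w)\<close>, regularity confines \<open>w\<close> to a box of side
      proportional to \<open>N\<close>, uniformly in \<open>p\<close>. The Cauchy--Schwarz inequality in \<open>w\<close> removes \<open>\<chi>(w)\<close>;
      expanding the square leaves the correlation sum and a diagonal of density \<open>A\<close> (lemma
      \<open>katai_inequality\<close>).

  Every density comes from one fact: the multiples of \<open>a\<close> have density \<open>1 / \<bar>N(a)\<bar>\<close> (lemma
  \<open>multiples_density\<close>). Counting \<open>w\<close> with \<open>a w\<close> in the box means counting integer points in the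
  preimage of a cube under the matrix of \<open>a\<close>, and a linear map scales volumes by the absolute value of its
  determinant. For \<open>p\<close> and \<open>q\<close> with coprime norms, being divisible by both is being divisible by
  \<open>p q\<close>, so no further counting is needed for the second moment of \<open>\<omega>\<close>.

  The error term \<open>\<rho>\<close> collects by how much three averages (the variance of \<open>\<omega>\<close>, the number of bad pairs,
  the diagonal) exceed the bounds on their limits. They involve neither \<open>\<chi>\<close> nor \<open>h\<close>, which makes
  \<open>\<rho>\<close> uniform.
\<close>

section \<open>Lattice points and volume\<close>

text \<open>
  The change of variables formula for linear maps, \<open>measure_linear_image\<close>, asks for an index type
  that is well-ordered. A copy of a finite type, ordered through an arbitrary injection into the natural
  numbers, reduces any finite index type to that case.
\<close>

typedef 'a ordered_copy = "UNIV :: 'a set" by simp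

definition index_of :: "'a::finite \<Rightarrow> nat" where
  "index_of = (SOME f. inj f)"

lemma inj_index_of: "inj (index_of :: 'a::finite \<Rightarrow> nat)"
proof -
  have "\<exists>f :: 'a \<Rightarrow> nat. inj f"
    using finite_imp_inj_to_nat_seg[of "UNIV :: 'a set"] by auto
  then show ?thesis unfolding index_of_def by (rule someI_ex)
qed

instance ordered_copy :: (finite) finite
  by intro_classes (simp add: type_definition.univ[OF type_definition_ordered_copy])

instantiation ordered_copy :: (finite) wellorder
begin

definition less_eq_ordered_copy :: "'a ordered_copy \<Rightarrow> 'a ordered_copy \<Rightarrow> bool" where
  "less_eq_ordered_copy x y \<longleftrightarrow> index_of (Rep_ordered_copy x) \<le> index_of (Rep_ordered_copy y)"

definition less_ordered_copy :: "'a ordered_copy \<Rightarrow> 'a ordered_copy \<Rightarrow> bool" where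
  "less_ordered_copy x y \<longleftrightarrow> index_of (Rep_ordered_copy x) < index_of (Rep_ordered_copy y)"

instance
proof
  fix x y z :: "'a ordered_copy"
  show "(x < y) = (x \<le> y \<and> \<not> y \<le> x)" "x \<le> x" "x \<le> y \<Longrightarrow> y \<le> z \<Longrightarrow> x \<le> z" "x \<le> y \<or> y \<le> x"
    by (auto simp: less_eq_ordered_copy_def less_ordered_copy_def)
  show "x \<le> y \<Longrightarrow> y \<le> x \<Longrightarrow> x = y"
    by (simp add: less_eq_ordered_copy_def Rep_ordered_copy_inject inj_eq[OF inj_index_of])
next
  fix P :: "'a ordered_copy \<Rightarrow> bool" and a
  assume step: "\<And>x. (\<And>y. y < x \<Longrightarrow> P y) \<Longrightarrow> P x"
  show "P a"
    by (induction a rule: measure_induct_rule[where f = "\<lambda>x. index_of (Rep_ordered_copy x)"])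
       (rule step, simp add: less_ordered_copy_def)
qed

end

text \<open>
  Conjugation with \<open>g\<close> is a bijection between the permutations of the two index types that preserves
  signs, so the two Leibniz sums agree term by term.
\<close>

lemma det_reindex:
  fixes A :: "'a::comm_ring_1^'n^'n" and g :: "'m::finite \<Rightarrow> 'n"
  assumes g: "bij g"
  shows "det (\<chi> i j. A $ g i $ g j) = det A"
proof -
  define g' where "g' = inv_into UNIV g"
  have [simp]: "bij g'" "\<And>x. g' (g x) = x" "\<And>x. g (g' x) = x"
    using g by (auto simp: g'_def bij_imp_bij_inv bij_is_inj bij_is_surj surj_f_inv_f)
  have [simp]: "inj g" "surj g" using g by (auto simp: bij_def)
  have 1: "bij_betw (map_permutation UNIV g) {p. p permutes (UNIV::'m set)} {p. p permutes (UNIV :: 'n set)}"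
  proof (rule bij_betwI[where g = "map_permutation UNIV g'"])
    show "map_permutation UNIV g \<in> {p. p permutes UNIV} \<rightarrow> {p. p permutes UNIV}"
      using g by (auto intro: map_permutation_permutes)
    show "map_permutation UNIV g' \<in> {p. p permutes UNIV} \<rightarrow> {p. p permutes UNIV}"
      using g by (auto intro!: map_permutation_permutes)
  next
    fix p :: "'m \<Rightarrow> 'm" assume "p \<in> {p. p permutes UNIV}"
    then show "map_permutation UNIV g' (map_permutation UNIV g p) = p"
      using g by (auto intro: map_permutation_compose_inv)
  next
    fix p :: "'n \<Rightarrow> 'n" assume "p \<in> {p. p permutes UNIV}"
    then show "map_permutation UNIV g (map_permutation UNIV g' p) = p"
      using g by (auto intro!: map_permutation_compose_inv)
  qed
  have 2: "(\<Prod>i\<in>UNIV. A $ i $ map_permutation UNIV g p i) = (\<Prod>i\<in>UNIV. A $ g i $ g (p i))"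
    if "p permutes UNIV" for p
  proof -
    have "(\<Prod>i\<in>UNIV. A $ g i $ map_permutation UNIV g p (g i)) = (\<Prod>i\<in>UNIV. A $ i $ map_permutation UNIV g p i)"
      by (rule prod.reindex_bij_betw[OF g])
    then show ?thesis by (simp add: map_permutation_apply)
  qed
  show ?thesis
    unfolding det_def
    by (subst sum.reindex_bij_betw[OF 1, symmetric])
       (auto intro!: sum.cong simp: sign_map_permutation 2)
qed

lemma finite_integer_box:
  "finite {w :: real^'n. \<forall>i. w $ i \<in> \<int> \<and> \<bar>w $ i\<bar> \<le> K}"
proof -
  let ?S = "{x :: real. x \<in> \<int> \<and> \<bar>x\<bar> \<le> K}"
  have "{w :: real^'n. \<forall>i. w $ i \<in> \<int> \<and> \<bar>w $ i\<bar> \<le> K} = {w. \<forall>i. w $ i \<in> ?S}"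
    by auto
  moreover have "finite {w :: real^'n. \<forall>i. w $ i \<in> ?S}"
  proof -
    have "{w :: real^'n. \<forall>i. w $ i \<in> ?S} \<subseteq> vec_lambda ` (UNIV \<rightarrow>\<^sub>E ?S)"
      by (auto simp: PiE_def extensional_def intro!: image_eqI[where x = "vec_nth _"] vec_eq_iff[THEN iffD2])
    moreover have "finite (UNIV \<rightarrow>\<^sub>E ?S :: ('n \<Rightarrow> real) set)"
      by (intro finite_PiE finite_abs_int_segment) auto
    ultimately show ?thesis using finite_surj by blast
  qed
  ultimately show ?thesis by simp
qed

lemma vector_matrix_bound:
  fixes A :: "real^'n^'m"
  assumes "\<And>i. \<bar>x $ i\<bar> \<le> K"
  shows "\<bar>(x v* A) $ j\<bar> \<le> K * (\<Sum>i\<in>UNIV. \<Sum>j\<in>UNIV. \<bar>A $ i $ j\<bar>)"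
proof -
  have K: "K \<ge> 0" using assms[of undefined] by linarith
  have "\<bar>(x v* A) $ j\<bar> \<le> (\<Sum>i\<in>UNIV. \<bar>x $ i * A $ i $ j\<bar>)"
    by (simp add: vector_matrix_mult_def)
  also have "\<dots> \<le> (\<Sum>i\<in>UNIV. K * (\<Sum>j\<in>UNIV. \<bar>A $ i $ j\<bar>))"
    unfolding abs_mult
    by (intro sum_mono mult_mono assms K member_le_sum) auto
  finally show ?thesis by (simp add: sum_distrib_left)
qed

text \<open>
  The half-open unit cubes with lower corner at the counted points \<open>w\<close> are disjoint, so their union has
  the number of points as its volume, and its image under \<open>x \<mapsto> x v* A\<close> has that volume times
  \<open>\<bar>det A\<bar>\<close>. The image of a cube stays within a constant \<open>c\<close> of the image of its corner; therefore
  the image of the union lies between the cubes of half side \<open>N - c\<close> and \<open>N + c\<close>.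
\<close>

lemma lattice_point_count_wellorder:
  fixes A :: "real^('n::{finite,wellorder})^('n::{finite,wellorder})"
  assumes d: "det A \<noteq> 0"
  shows "(\<lambda>N. real (card {w. (\<forall>i. w $ i \<in> \<int>) \<and> (\<forall>j. \<bar>(w v* A) $ j\<bar> \<le> real N)})
            / (2 * real N + 1) ^ CARD('n)) \<longlonglongrightarrow> 1 / \<bar>det A\<bar>"
proof -
  define F where "F N = {w. (\<forall>i. w $ i \<in> \<int>) \<and> (\<forall>j. \<bar>(w v* A) $ j\<bar> \<le> real N)}" for N
  \<comment> \<open>bounds every coordinate of \<open>x v* A\<close> for \<open>x\<close> in the unit cube\<close>
  define c where "c = nat \<lceil>\<Sum>i\<in>UNIV. \<Sum>j\<in>UNIV. \<bar>A $ i $ j\<bar>\<rceil>"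
  have c: "(\<Sum>i\<in>UNIV. \<Sum>j\<in>UNIV. \<bar>A $ i $ j\<bar>) \<le> real c"
    unfolding c_def by linarith
  define f where "f x = x v* A" for x :: "real^('n::{finite,wellorder})"
  have lin: "linear f"
    unfolding f_def by (rule linearI) (simp_all add: vector_matrix_left_distrib scaleR_vector_matrix_assoc)
  have detf: "det (matrix f) = det A"
  proof -
    have "f = (*v) (transpose A)" by (simp add: f_def fun_eq_iff)
    then have "matrix f = transpose A" by (simp only: matrix_of_matrix_vector_mul)
    then show ?thesis by (simp add: det_transpose)
  qed
  obtain B where B: "A ** B = mat 1" "B ** A = mat 1"
    using d unfolding invertible_det_nz[symmetric] invertible_def by blast
  have fB: "f x v* B = x" "f (x v* B) = x" for x
    using B by (simp_all add: f_def vector_matrix_mul_assoc)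
  have fin: "finite (F N)" for N
  proof (rule finite_subset[OF _ finite_integer_box])
    show "F N \<subseteq> {w. \<forall>i. w $ i \<in> \<int> \<and> \<bar>w $ i\<bar> \<le> real N * (\<Sum>i\<in>UNIV. \<Sum>j\<in>UNIV. \<bar>B $ i $ j\<bar>)}"
    proof safe
      fix w i assume "w \<in> F N"
      then show "\<bar>w $ i\<bar> \<le> real N * (\<Sum>i\<in>UNIV. \<Sum>j\<in>UNIV. \<bar>B $ i $ j\<bar>)"
        using vector_matrix_bound[of "f w" "real N" B i] fB(1)[of w] by (auto simp: F_def f_def)
    qed (auto simp: F_def)
  qed
  \<comment> \<open>half-open, so that cubes at different integer points are disjoint\<close>
  define H where "H (w :: real^('n::{finite,wellorder})) = {x. \<forall>i. w $ i \<le> x $ i \<and> x $ i < w $ i + 1}" for w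
  have Hm: "H w \<in> lmeasurable \<and> measure lebesgue (H w) = 1" for w
  proof -
    have b: "H w \<in> sets borel"
    proof -
      have "H w = (\<Inter>i. {x. w $ i \<le> x $ i} \<inter> {x. x $ i < w $ i + 1})" by (auto simp: H_def)
      also have "\<dots> \<in> sets borel" by measurable
      finally show ?thesis .
    qed
    have s: "box w (w + 1) \<subseteq> H w" "H w \<subseteq> cbox w (w + 1)"
      by (auto simp: H_def mem_box_cart less_imp_le)
    have cont: "measure lebesgue (cbox w (w + 1)) = 1" "measure lebesgue (box w (w + 1)) = 1"
    proof -
      have "cbox w (w+1) \<noteq> {}" by (auto simp: interval_ne_empty_cart)
      then show "measure lebesgue (cbox w (w + 1)) = 1"
        by (simp add: content_cbox_cart)
      then show "measure lebesgue (box w (w + 1)) = 1"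
        by (simp add: measure_lborel_box_eq measure_lborel_cbox_eq)
    qed
    have Hl: "H w \<in> lmeasurable"
    proof (rule bounded_set_imp_lmeasurable)
      show "bounded (H w)" using s(2) bounded_cbox bounded_subset by blast
      show "H w \<in> sets lebesgue" using b by simp
    qed
    moreover have "measure lebesgue (H w) \<le> 1"
      using measure_mono_fmeasurable[OF s(2), of lebesgue] fmeasurableD[OF Hl] cont(1) by simp
    moreover have "measure lebesgue (H w) \<ge> 1"
      using measure_mono_fmeasurable[OF s(1), of lebesgue] Hl cont(2) by simp
    ultimately show ?thesis by auto
  qed
  define U where "U N = (\<Union>w\<in>F N. H w)" for N
  have disj: "disjoint_family_on H (F N)" for N
    unfolding disjoint_family_on_def
  proof (intro ballI impI)
    fix v w assume vw: "v \<in> F N" "w \<in> F N" "v \<noteq> w"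
    show "H v \<inter> H w = {}"
    proof (rule ccontr)
      assume "H v \<inter> H w \<noteq> {}"
      then obtain x where x: "x \<in> H v" "x \<in> H w" by auto
      have "v $ i = w $ i" for i
      proof -
        obtain k l where kl: "v $ i = of_int k" "w $ i = of_int l"
          using vw by (auto simp: F_def elim!: Ints_cases) (metis Ints_cases)
        moreover have "\<lfloor>x $ i\<rfloor> = k" "\<lfloor>x $ i\<rfloor> = l"
        proof -
          have "v $ i \<le> x $ i \<and> x $ i < v $ i + 1" "w $ i \<le> x $ i \<and> x $ i < w $ i + 1"
            using x unfolding H_def by blast+
          then show "\<lfloor>x $ i\<rfloor> = k" "\<lfloor>x $ i\<rfloor> = l" using kl by (auto simp: floor_eq_iff)
        qed
        ultimately show ?thesis by simp
      qed
      then show False using vw by (simp add: vec_eq_iff)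
    qed
  qed
  have Um: "U N \<in> lmeasurable" "measure lebesgue (U N) = real (card (F N))" for N
  proof -
    show "U N \<in> lmeasurable" unfolding U_def using fin Hm by (intro fmeasurable.finite_UN) auto
    have H: "H w \<in> lmeasurable" for w using Hm by blast
    have "measure lebesgue (U N) = (\<Sum>w\<in>F N. measure lebesgue (H w))"
      unfolding U_def using fmeasurableD[OF H] fmeasurableD2[OF H]
      by (intro measure_finite_Union fin disj image_subsetI) (simp_all only: infinity_ennreal_def not_False_eq_True)
    then show "measure lebesgue (U N) = real (card (F N))" using Hm by simp
  qed
  have fU: "f ` U N \<in> lmeasurable" "measure lebesgue (f ` U N) = \<bar>det A\<bar> * real (card (F N))" for N
    using measurable_linear_image[OF lin Um(1)] measure_linear_image[OF lin Um(1)] detf Um(2) by auto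
  have diff: "\<bar>f x $ j - f w $ j\<bar> \<le> real c" if "x \<in> H w" for x w j
  proof -
    have "\<bar>(x - w) $ i\<bar> \<le> 1" for i using that by (auto simp: H_def) (smt (verit))
    then have "\<bar>f (x - w) $ j\<bar> \<le> 1 * (\<Sum>i\<in>UNIV. \<Sum>j\<in>UNIV. \<bar>A $ i $ j\<bar>)"
      unfolding f_def by (rule vector_matrix_bound)
    then show ?thesis using c linear_diff[OF lin, of x w] by simp
  qed
  define Q :: "real \<Rightarrow> (real^('n::{finite,wellorder})) set" where "Q t = cbox (\<chi> i. - t) (\<chi> i. t)" for t
  have Qm: "Q t \<in> lmeasurable" "t \<ge> 0 \<Longrightarrow> measure lebesgue (Q t) = (2 * t) ^ CARD('n)" for t
  proof -
    show "Q t \<in> lmeasurable" by (simp add: Q_def)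
    assume "t \<ge> 0"
    then have "Q t \<noteq> {}" by (auto simp: Q_def interval_ne_empty_cart)
    then show "measure lebesgue (Q t) = (2 * t) ^ CARD('n)"
      by (simp add: Q_def content_cbox_cart)
  qed
  have upper: "f ` U N \<subseteq> Q (real N + real c)" for N
  proof
    fix y assume "y \<in> f ` U N"
    then obtain x w where xw: "y = f x" "x \<in> H w" "w \<in> F N" by (auto simp: U_def)
    have "\<bar>f x $ j\<bar> \<le> real N + real c" for j
    proof -
      have "\<bar>f w $ j\<bar> \<le> real N" using xw by (auto simp: F_def f_def)
      then show ?thesis using diff[OF xw(2), of j] by linarith
    qed
    then show "y \<in> Q (real N + real c)" unfolding xw(1) Q_def mem_box_cart
      by (smt (verit, del_insts) vec_lambda_beta)
  qed
  have lower: "Q (real N - real c) \<subseteq> f ` U N" for N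
  proof
    fix y assume y: "y \<in> Q (real N - real c)"
    define x where "x = y v* B"
    have yx: "y = f x" using fB(2)[of y] by (simp add: x_def)
    define w where "w = (\<chi> i. real_of_int \<lfloor>x $ i\<rfloor>)"
    have xw: "x \<in> H w" by (auto simp: H_def w_def)
    have "\<bar>f w $ j\<bar> \<le> real N" for j
    proof -
      have "\<bar>y $ j\<bar> \<le> real N - real c" using y unfolding Q_def mem_box_cart
        by (smt (verit, del_insts) vec_lambda_beta)
      then show ?thesis using diff[OF xw, of j] unfolding yx by linarith
    qed
    then have "w \<in> F N" by (auto simp: F_def w_def f_def)
    then show "y \<in> f ` U N" using xw yx by (auto simp: U_def)
  qed
  have up: "real (card (F N)) \<le> (2 * (real N + real c)) ^ CARD('n) / \<bar>det A\<bar>" for N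
    using measure_mono_fmeasurable[OF upper[of N] fmeasurableD[OF fU(1)] Qm(1)] fU(2) Qm(2)[of "real N + real c"] d
    by (auto simp: field_simps)
  have lo: "(2 * (real N - real c)) ^ CARD('n) / \<bar>det A\<bar> \<le> real (card (F N))" if "N \<ge> c" for N
    using measure_mono_fmeasurable[OF lower[of N] fmeasurableD[OF Qm(1)] fU(1)] fU(2) Qm(2)[of "real N - real c"] d that
    by (auto simp: field_simps)
  have "(\<lambda>N. real (card (F N)) / (2 * real N + 1) ^ CARD('n)) \<longlonglongrightarrow> 1 / \<bar>det A\<bar>"
  proof (rule tendsto_sandwich)
    show "\<forall>\<^sub>F N in sequentially. ((2 * (real N - real c)) / (2 * real N + 1)) ^ CARD('n) / \<bar>det A\<bar>
       \<le> real (card (F N)) / (2 * real N + 1) ^ CARD('n)"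
      using eventually_ge_at_top[of c]
      by eventually_elim (use lo in \<open>simp add: power_divide divide_right_mono field_simps\<close>)
    show "\<forall>\<^sub>F N in sequentially. real (card (F N)) / (2 * real N + 1) ^ CARD('n)
       \<le> ((2 * (real N + real c)) / (2 * real N + 1)) ^ CARD('n) / \<bar>det A\<bar>"
      using up by (intro always_eventually) (simp add: power_divide divide_right_mono field_simps)
    have "(\<lambda>N. (2 * (real N - real c)) / (2 * real N + 1)) \<longlonglongrightarrow> 1"
      by real_asymp
    from tendsto_divide[OF tendsto_power[OF this, of "CARD('n)"] tendsto_const, of "\<bar>det A\<bar>"]
    show "(\<lambda>N. ((2 * (real N - real c)) / (2 * real N + 1)) ^ CARD('n) / \<bar>det A\<bar>) \<longlonglongrightarrow> 1 / \<bar>det A\<bar>"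
      using d by simp
    have "(\<lambda>N. (2 * (real N + real c)) / (2 * real N + 1)) \<longlonglongrightarrow> 1"
      by real_asymp
    from tendsto_divide[OF tendsto_power[OF this, of "CARD('n)"] tendsto_const, of "\<bar>det A\<bar>"]
    show "(\<lambda>N. ((2 * (real N + real c)) / (2 * real N + 1)) ^ CARD('n) / \<bar>det A\<bar>) \<longlonglongrightarrow> 1 / \<bar>det A\<bar>"
      using d by simp
  qed
  then show ?thesis by (simp add: F_def)
qed

text \<open>
  Renumbering the coordinates changes neither the number of points nor the determinant.
\<close>

lemma lattice_point_count:
  fixes A :: "real^'d^'d"
  assumes d: "det A \<noteq> 0"
  shows "(\<lambda>N. real (card {w. (\<forall>i. w $ i \<in> \<int>) \<and> (\<forall>j. \<bar>(w v* A) $ j\<bar> \<le> real N)})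
            / (2 * real N + 1) ^ CARD('d)) \<longlonglongrightarrow> 1 / \<bar>det A\<bar>"
proof -
  define g :: "'d ordered_copy \<Rightarrow> 'd" where "g = Rep_ordered_copy"
  have g: "bij g" unfolding g_def by (metis Abs_ordered_copy_inverse Rep_ordered_copy_inverse UNIV_I bijI')
  define g' where "g' = inv_into UNIV g"
  have [simp]: "\<And>x. g' (g x) = x" "\<And>x. g (g' x) = x"
    using g by (auto simp: g'_def bij_is_inj bij_is_surj surj_f_inv_f)
  define A' where "A' = (\<chi> i j. A $ g i $ g j)"
  have dA: "det A' = det A" unfolding A'_def by (rule det_reindex[OF g])
  have cd: "CARD('d ordered_copy) = CARD('d)" using bij_betw_same_card[OF g] .
  have "card {w. (\<forall>i. w $ i \<in> \<int>) \<and> (\<forall>j. \<bar>(w v* A') $ j\<bar> \<le> real N)} =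
        card {w. (\<forall>i. w $ i \<in> \<int>) \<and> (\<forall>j. \<bar>(w v* A) $ j\<bar> \<le> real N)}" for N
  proof (rule bij_betw_same_card[where f = "\<lambda>w. \<chi> i. w $ g' i"], rule bij_betwI[where g = "\<lambda>w. \<chi> i. w $ g i"])
    have 1: "((\<chi> i. w $ g i) v* A') $ j = (w v* A) $ g j" for w j
      unfolding vector_matrix_mult_def A'_def
      using sum.reindex_bij_betw[OF g, of "\<lambda>i. w $ i * A $ i $ g j"] by simp
    have 2: "(\<chi> i. (\<chi> i. w $ g' i) $ g i) = w" for w :: "real^'d ordered_copy"
      by (simp add: vec_eq_iff)
    have 3: "(\<chi> i. (\<chi> i. w $ g i) $ g' i) = w" for w :: "real^'d"
      by (simp add: vec_eq_iff)
    show "(\<chi> i. (\<chi> i. w $ g' i) $ g i) = w" for w :: "real^'d ordered_copy" by (rule 2)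
    show "(\<chi> i. (\<chi> i. w $ g i) $ g' i) = w" for w :: "real^'d" by (rule 3)
    have 4: "(w v* A') $ j = ((\<chi> i. w $ g' i) v* A) $ g j" for w j
      using 1[of "\<chi> i. w $ g' i" j] 2[of w] by simp
    have 5: "(\<forall>j. P (g j)) = (\<forall>j. P j)" for P using g by (metis bij_pointE)
    show "(\<lambda>w. \<chi> i. w $ g' i) \<in> {w. (\<forall>i. w $ i \<in> \<int>) \<and> (\<forall>j. \<bar>(w v* A') $ j\<bar> \<le> real N)} \<rightarrow>
      {w. (\<forall>i. w $ i \<in> \<int>) \<and> (\<forall>j. \<bar>(w v* A) $ j\<bar> \<le> real N)}"
      unfolding 4 using 5[of "\<lambda>j. \<bar>((\<chi> i. _ $ g' i) v* A) $ j\<bar> \<le> real N"] by auto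
    show "(\<lambda>w. \<chi> i. w $ g i) \<in> {w. (\<forall>i. w $ i \<in> \<int>) \<and> (\<forall>j. \<bar>(w v* A) $ j\<bar> \<le> real N)} \<rightarrow>
      {w. (\<forall>i. w $ i \<in> \<int>) \<and> (\<forall>j. \<bar>(w v* A') $ j\<bar> \<le> real N)}"
      using 1 by auto
  qed
  then show ?thesis
    using lattice_point_count_wellorder[of A'] d by (simp add: dA cd)
qed

section \<open>Algebraic integers\<close>

text \<open>
  Evaluation of an integer polynomial at an element of a larger ring; a ring homomorphism in the polynomial.
\<close>

definition ipoly :: "int poly \<Rightarrow> 'a::comm_ring_1 \<Rightarrow> 'a" where
  "ipoly p x = poly (map_poly of_int p) x"

lemma ipoly_0 [simp]: "ipoly 0 x = 0"
  by (simp add: ipoly_def)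

lemma ipoly_pCons [simp]: "ipoly (pCons a p) x = of_int a + x * ipoly p x"
  by (simp add: ipoly_def map_poly_pCons)

lemma ipoly_add [simp]: "ipoly (p + q) x = ipoly p x + ipoly q x"
  by (induction p q rule: poly_induct2) (simp_all add: algebra_simps)

lemma ipoly_minus [simp]: "ipoly (- p) x = - ipoly p x"
  by (induction p) (simp_all add: algebra_simps)

lemma ipoly_diff [simp]: "ipoly (p - q) x = ipoly p x - ipoly q x"
  using ipoly_add[of p "- q" x] by simp

lemma ipoly_smult [simp]: "ipoly (smult a p) x = of_int a * ipoly p x"
  by (induction p) (simp_all add: algebra_simps)

lemma ipoly_mult [simp]: "ipoly (p * q) x = ipoly p x * ipoly q x"
  by (induction p) (simp_all add: algebra_simps)

lemma algebraic_int_ipoly_iff: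
  fixes x :: "'a::field_char_0"
  shows "algebraic_int x \<longleftrightarrow> (\<exists>p. ipoly p x = 0 \<and> lead_coeff p = 1)"
  by (simp add: algebraic_int_altdef_ipoly ipoly_def)

text \<open>
  A determinant-free form of the criterion that \<open>w\<close> is integral if it maps a finitely generated
  module into itself. The hypotheses describe a square system in the unknowns \<open>v\<close> that is diagonally
  dominant with respect to degrees. Eliminating an unknown \<open>v m\<close> by cross-multiplication with the pivot
  \<open>M m m\<close> preserves this shape and doubles \<open>d\<close>. Once only \<open>v k \<noteq> 0\<close> is left, the single remaining
  coefficient is a monic polynomial that vanishes at \<open>w\<close>.
\<close>

lemma algebraic_int_of_poly_system:
  fixes w :: "'a::field_char_0" and v :: "'i \<Rightarrow> 'a" and M :: "'i \<Rightarrow> 'i \<Rightarrow> int poly"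
  assumes "finite I" "k \<in> I" "v k \<noteq> 0" "d > 0"
    and "\<And>i. i \<in> I \<Longrightarrow> degree (M i i) = d \<and> lead_coeff (M i i) = 1"
    and "\<And>i j. i \<in> I \<Longrightarrow> j \<in> I \<Longrightarrow> i \<noteq> j \<Longrightarrow> degree (M i j) < d"
    and "\<And>i. i \<in> I \<Longrightarrow> (\<Sum>j\<in>I. ipoly (M i j) w * v j) = 0"
  shows "algebraic_int w"
  using assms
proof (induction "card I" arbitrary: I M d rule: less_induct)
  case (less I M d)
  note diag = less.prems(5) and off = less.prems(6) and sys = less.prems(7)
  show ?case
  proof (cases "I = {k}")
    case True
    then have "ipoly (M k k) w = 0" using sys[of k] less.prems(3) by simp
    then show ?thesis using diag[of k] True algebraic_int_ipoly_iff by blast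
  next
    case False
    then obtain m where m: "m \<in> I" "m \<noteq> k" using less.prems(2) by auto
    define J where "J = I - {m}"
    \<comment> \<open>subtract multiples of row \<open>m\<close> so that the entries in column \<open>m\<close> cancel\<close>
    define M' where "M' i j = M m m * M i j - M i m * M m j" for i j
    have J: "finite J" "k \<in> J" "card J < card I" "J \<subseteq> I"
      using m less.prems(1,2) card_Diff1_less[of I m] by (auto simp: J_def)
    have split: "(\<Sum>j\<in>I. g j) = g m + (\<Sum>j\<in>J. g j)" for g :: "'i \<Rightarrow> 'a"
      unfolding J_def using m less.prems(1) by (simp add: sum.remove)
    have lt: "degree (M i m * M m j) < 2 * d" if "i \<in> J" "j \<in> J" for i j
    proof -
      have "degree (M i m) < d" "degree (M m j) < d"
        using off[of i m] off[of m j] that m by (auto simp: J_def)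
      then show ?thesis using degree_mult_le[of "M i m" "M m j"] by linarith
    qed
    have mm: "degree (M m m) = d" "lead_coeff (M m m) = 1" using diag m by auto
    have nz: "M m m \<noteq> 0" "\<And>i. i \<in> I \<Longrightarrow> M i i \<noteq> 0"
      using diag m(1) by fastforce+
    show ?thesis
    proof (rule less.hyps[of J "2 * d" M'])
      fix i assume i: "i \<in> J"
      then have ii: "degree (M i i) = d" "lead_coeff (M i i) = 1" "M i i \<noteq> 0"
        using diag[of i] nz J by auto
      have 1: "degree (M m m * M i i) = 2 * d" "lead_coeff (M m m * M i i) = 1"
        using ii mm nz degree_mult_eq[of "M m m" "M i i"] lead_coeff_mult[of "M m m" "M i i"] by simp_all
      have e: "M' i i = - (M i m * M m i) + M m m * M i i" by (simp add: M'_def)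
      have l: "degree (- (M i m * M m i)) < degree (M m m * M i i)"
        using lt[OF i i] 1 by simp
      show "degree (M' i i) = 2 * d \<and> lead_coeff (M' i i) = 1"
        using degree_add_eq_right[OF l] lead_coeff_add_le[OF l] 1 unfolding e by simp
    next
      fix i j assume ij: "i \<in> J" "j \<in> J" "i \<noteq> j"
      have "degree (M m m * M i j) < 2 * d"
        using degree_mult_le[of "M m m" "M i j"] off[of i j] ij J mm by fastforce
      then show "degree (M' i j) < 2 * d"
        unfolding M'_def using lt[OF ij(1,2)] by (rule degree_diff_less)
    next
      fix i assume i: "i \<in> J"
      have "(\<Sum>j\<in>J. ipoly (M' i j) w * v j) =
          ipoly (M m m) w * (\<Sum>j\<in>J. ipoly (M i j) w * v j) - ipoly (M i m) w * (\<Sum>j\<in>J. ipoly (M m j) w * v j)"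
        by (simp add: M'_def algebra_simps sum_subtractf sum_distrib_left)
      also have "(\<Sum>j\<in>J. ipoly (M i j) w * v j) = - ipoly (M i m) w * v m"
        using sys[of i] split i J by (auto simp: eq_neg_iff_add_eq_0 add.commute)
      also have "(\<Sum>j\<in>J. ipoly (M m j) w * v j) = - ipoly (M m m) w * v m"
        using sys[of m] split m by (auto simp: eq_neg_iff_add_eq_0 add.commute)
      finally show "(\<Sum>j\<in>J. ipoly (M' i j) w * v j) = 0" by simp
    qed (use J less.prems in auto)
  qed
qed

text \<open>
  The witness \<open>c\<close> is the companion matrix of a monic polynomial with the root \<open>x\<close>.
\<close>

lemma power_reduction:
  fixes x :: "'a::field_char_0"
  assumes "algebraic_int x"
  obtains n c where "n > 0" "\<And>i. i < n \<Longrightarrow> x ^ Suc i = (\<Sum>j<n. of_int (c i j :: int) * x ^ j)"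
proof -
  obtain p where p: "ipoly p x = 0" "lead_coeff p = 1"
    using assms algebraic_int_ipoly_iff by blast
  define n where "n = degree p"
  have pn: "ipoly p x = (\<Sum>j\<le>n. of_int (coeff p j) * x ^ j)"
    unfolding ipoly_def n_def
    by (subst poly_altdef) (simp add: map_poly_degree_eq coeff_map_poly p(2))
  have "n > 0"
  proof (rule ccontr)
    assume "\<not> n > 0"
    then show False using pn p by (simp add: n_def)
  qed
  have top: "x ^ n = (\<Sum>j<n. of_int (- coeff p j) * x ^ j)"
  proof -
    have "(\<Sum>j<n. of_int (coeff p j) * x ^ j) + x ^ n = 0"
      using pn p by (simp add: n_def lessThan_Suc_atMost[symmetric])
    then show ?thesis by (simp add: sum_negf eq_neg_iff_add_eq_0 add.commute)
  qed
  define c where "c i j = (if Suc i = n then - coeff p j else of_bool (j = Suc i))" for i j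
  have "x ^ Suc i = (\<Sum>j<n. of_int (c i j) * x ^ j)" if "i < n" for i
  proof (cases "Suc i = n")
    case True
    then show ?thesis using top by (simp add: c_def)
  next
    case False
    then have "(\<Sum>j<n. of_int (c i j) * x ^ j) = (\<Sum>j<n. if j = Suc i then x ^ j else 0)"
      by (intro sum.cong) (auto simp: c_def)
    also have "\<dots> = x ^ Suc i" using that False by (subst sum.delta) auto
    finally show ?thesis by simp
  qed
  with \<open>n > 0\<close> show ?thesis using that by blast
qed

text \<open>
  Multiplication by \<open>x * y\<close> maps the span of the finitely many monomials \<open>x ^ i * y ^ j\<close> below the degrees
  into itself, by an integer matrix \<open>a\<close>; the system to solve has the matrix \<open>X - a\<close>.
\<close>

lemma algebraic_int_mult:
  fixes x y :: "'a::field_char_0"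
  assumes "algebraic_int x" "algebraic_int y"
  shows "algebraic_int (x * y)"
proof -
  obtain m c where m: "m > 0" and c: "\<And>i. i < m \<Longrightarrow> x ^ Suc i = (\<Sum>j<m. of_int (c i j :: int) * x ^ j)"
    using power_reduction[OF assms(1)] by metis
  obtain n e where n: "n > 0" and e: "\<And>i. i < n \<Longrightarrow> y ^ Suc i = (\<Sum>j<n. of_int (e i j :: int) * y ^ j)"
    using power_reduction[OF assms(2)] by metis
  define I where "I = {..<m} \<times> {..<n}"
  define v where "v = (\<lambda>(i, j). x ^ i * y ^ j)"
  define a where "a = (\<lambda>(i, j) (i', j'). c i i' * e j j')"
  \<comment> \<open>the matrix \<open>X - a\<close>\<close>
  define M where "M r s = (if r = s then [: - a r s, 1 :] else [: - a r s :])" for r s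
  have step: "x * y * v r = (\<Sum>s\<in>I. of_int (a r s) * v s)" if rI: "r \<in> I" for r
  proof -
    obtain i j where r: "r = (i, j)" "i < m" "j < n" using rI by (cases r) (auto simp: I_def)
    have "x * y * v r = x ^ Suc i * y ^ Suc j" by (simp add: r v_def)
    also have "\<dots> = (\<Sum>s\<in>I. of_int (a r s) * v s)"
      unfolding c[OF r(2)] e[OF r(3)] sum_product I_def sum.cartesian_product
      by (intro sum.cong) (auto simp: a_def v_def r)
    finally show ?thesis .
  qed
  show ?thesis
  proof (rule algebraic_int_of_poly_system[of I "(0, 0)" v 1 M])
    fix r assume r: "r \<in> I"
    have "(\<Sum>s\<in>I. ipoly (M r s) (x * y) * v s) = (\<Sum>s\<in>I. (if s = r then x * y * v r else 0) - of_int (a r s) * v s)"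
      by (intro sum.cong) (auto simp: M_def algebra_simps)
    also have "\<dots> = 0"
      using step[OF r] r by (simp add: sum_subtractf I_def)
    finally show "(\<Sum>s\<in>I. ipoly (M r s) (x * y) * v s) = 0" .
  qed (use m n in \<open>auto simp: I_def v_def M_def\<close>)
qed

section \<open>Roots of monic integer polynomials modulo a prime\<close>

text \<open>
  As over a field, a root \<open>t\<close> splits off a linear factor up to a multiple of \<open>l\<close>, and \<open>l\<close> being prime
  makes every other root a root of the cofactor.
\<close>

lemma card_roots_mod_prime_le_degree:
  fixes f :: "int poly"
  assumes "prime l" "lead_coeff f = 1" "S \<subseteq> {0..<l}" "\<And>t. t \<in> S \<Longrightarrow> l dvd poly f t"
  shows "card S \<le> degree f"
  using assms(2-)
proof (induction "degree f" arbitrary: f S)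
  case 0
  then have "f = 1" by (metis degree_eq_zeroE lead_coeff_pCons(2) one_pCons)
  then have "S = {}" using 0 \<open>prime l\<close> by fastforce
  then show ?case by simp
next
  case (Suc n f S)
  show ?case
  proof (cases "S = {}")
    case False
    then obtain t where t: "t \<in> S" by auto
    define g where "g = synthetic_div f t"
    have f: "f = [:poly f t:] + [:-t, 1:] * g"
      using synthetic_div_correct'[of t f] by (simp add: g_def add.commute)
    have dg: "degree g = n" using Suc.hyps(2) by (simp add: g_def degree_synthetic_div)
    have "g \<noteq> 0" using Suc.hyps(2) synthetic_div_eq_0_iff[of f t] by (auto simp: g_def)
    then have "degree [:poly f t:] < degree ([:-t, 1:] * g)"
      by (subst degree_mult_eq) auto
    from lead_coeff_add_le[OF this] have "lead_coeff ([:-t, 1:] * g) = 1"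
      using f Suc.prems(1) by metis
    then have lg: "lead_coeff g = 1"
      unfolding lead_coeff_mult by simp
    have "card (S - {t}) \<le> degree g"
    proof (rule Suc.hyps(1))
      fix u assume u: "u \<in> S - {t}"
      have "poly f u = poly f t + (u - t) * poly g u"
        by (subst f) (simp add: algebra_simps)
      then have "l dvd (u - t) * poly g u"
        using Suc.prems(3)[of u] Suc.prems(3)[OF t] u by (simp add: dvd_add_right_iff)
      moreover have "\<not> l dvd u - t"
      proof
        assume "l dvd u - t"
        moreover have "u \<in> {0..<l}" "t \<in> {0..<l}" using Suc.prems(2) u t by auto
        then have "\<bar>u - t\<bar> < l" by auto
        ultimately show False using u dvd_imp_le_int[of "u - t" l] by auto
      qed
      ultimately show "l dvd poly g u" using \<open>prime l\<close> by (simp add: prime_dvd_mult_iff)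
    qed (use dg lg Suc.prems in auto)
    moreover have "finite S" using Suc.prems(2) finite_subset by blast
    ultimately show ?thesis using t dg Suc.hyps(2) by (simp add: card_Diff_singleton_if)
  qed simp
qed

lemma det_map_of_int: "det (map_matrix of_int A :: 'a::comm_ring_1^'n^'n) = of_int (det A)"
  by (simp add: det_def)

text \<open>
  Up to signs, \<open>f\<close> is the characteristic polynomial of \<open>A\<close> at \<open>- t\<close>. In the Leibniz sum over the
  polynomial ring only the identity permutation meets all diagonal entries, so it alone contributes in degree
  \<open>CARD('n)\<close>.
\<close>

lemma det_shift_monic_poly:
  fixes A :: "int^'n^'n"
  obtains f :: "int poly" where "lead_coeff f = 1" "degree f = CARD('n)"
    "\<And>t. det (A + mat t) = poly f t"
proof -
  define M :: "int poly^'n^'n" where "M = (\<chi> i j. [:A $ i $ j, of_bool (i = j):])"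
  define T where "T p = (\<Prod>i\<in>UNIV. M $ i $ p i)" for p
  have deg: "degree (M $ i $ j) = of_bool (i = j)" for i j by (simp add: M_def)
  have id: "degree (T id) = CARD('n)" "lead_coeff (T id) = 1"
  proof -
    have "M $ i $ i \<noteq> 0" for i by (simp add: M_def)
    then show "degree (T id) = CARD('n)" by (simp add: T_def degree_prod_sum_eq deg)
    show "lead_coeff (T id) = 1" unfolding T_def lead_coeff_prod by (simp add: M_def)
  qed
  have other: "degree (of_int (sign p) * T p) < CARD('n)" if p: "p permutes UNIV" "p \<noteq> id" for p
  proof -
    obtain i where i: "p i \<noteq> i" using p(2) by (auto simp: fun_eq_iff)
    have "degree (T p) \<le> (\<Sum>i\<in>UNIV. of_bool (i = p i))"
      unfolding T_def using degree_prod_sum_le[of UNIV "\<lambda>i. M $ i $ p i"] by (simp add: deg o_def)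
    also have "\<dots> < (\<Sum>i\<in>(UNIV :: 'n set). 1)"
      using i by (intro sum_strict_mono_ex1) (auto intro!: exI[of _ i])
    finally have "degree (T p) < CARD('n)" by simp
    moreover have "degree (of_int (sign p) * T p) = degree (T p)"
      by (cases "evenperm p") (simp_all add: sign_def)
    ultimately show ?thesis by simp
  qed
  have split: "det M = (\<Sum>p\<in>{p. p permutes UNIV} - {id}. of_int (sign p) * T p) + T id"
    unfolding det_def T_def
    by (subst sum.remove[of _ id]) (auto simp: permutes_id sign_id finite_permutations add.commute)
  have "degree (\<Sum>p\<in>{p. p permutes UNIV} - {id}. of_int (sign p) * T p) < CARD('n)"
    by (rule degree_sum_less) (use other in auto)
  then have less: "degree (\<Sum>p\<in>{p. p permutes UNIV} - {id}. of_int (sign p) * T p) < degree (T id)"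
    using id by simp
  have "det (A + mat t) = poly (det M) t" for t
  proof -
    have "poly (M $ i $ j) t = (A + mat t) $ i $ j" for i j by (simp add: M_def mat_def)
    moreover have "poly (of_int k) t = k" for k :: int by (simp add: of_int_poly)
    ultimately show ?thesis by (simp add: det_def poly_sum poly_prod)
  qed
  with degree_add_eq_right[OF less] lead_coeff_add_le[OF less] show ?thesis
    using that[of "det M"] id unfolding split by simp
qed

lemma card_singular_shifts_le:
  fixes A :: "int^'n^'n"
  assumes "prime l"
  shows "card {t \<in> {0..<l}. l dvd det (A + mat t)} \<le> CARD('n)"
proof -
  obtain f :: "int poly" where f: "lead_coeff f = 1" "degree f = CARD('n)"
    "\<And>t. det (A + mat t) = poly f t" using det_shift_monic_poly[of A] by blast
  show ?thesis unfolding f(2)[symmetric]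
    by (rule card_roots_mod_prime_le_degree[OF assms f(1)]) (auto simp: f(3))
qed

section \<open>The combinatorial inequality\<close>

lemma sum_norm_le_sqrt:
  fixes F :: "'a \<Rightarrow> 'b::real_normed_vector"
  shows "(\<Sum>x\<in>S. norm (F x)) \<le> sqrt (real (card S) * (\<Sum>x\<in>S. (norm (F x))\<^sup>2))"
proof (rule real_le_rsqrt)
  show "(\<Sum>x\<in>S. norm (F x))\<^sup>2 \<le> real (card S) * (\<Sum>x\<in>S. (norm (F x))\<^sup>2)"
    using Cauchy_Schwarz_ineq_sum[of "\<lambda>_. 1" "\<lambda>x. norm (F x)" S] by simp
qed

definition divisor_count :: "'k::field set \<Rightarrow> 'k set \<Rightarrow> 'k \<Rightarrow> real" where
  "divisor_count R P z = (\<Sum>p\<in>P. of_bool (\<exists>w\<in>R. z = p * w))"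

text \<open>
  As \<open>p\<close> is nonzero, a multiple \<open>z\<close> determines its cofactor \<open>w\<close>.
\<close>

lemma sum_divisible:
  fixes F :: "'k::field \<Rightarrow> 'a::comm_ring_1"
  assumes "finite B" "p \<noteq> 0"
  shows "(\<Sum>z\<in>B. of_bool (\<exists>w\<in>R. z = p * w) * F z) = (\<Sum>w\<in>{w \<in> R. p * w \<in> B}. F (p * w))"
proof -
  have inj: "inj_on ((*) p) {w \<in> R. p * w \<in> B}" using assms(2) by (auto simp: inj_on_def)
  have "(\<Sum>z\<in>B. of_bool (\<exists>w\<in>R. z = p * w) * F z) = (\<Sum>z\<in>{z \<in> B. \<exists>w\<in>R. z = p * w}. F z)"
    using assms(1) by (simp add: of_bool_def if_distrib[of "\<lambda>x. x * _"] sum.inter_filter cong: if_cong)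
  also have "{z \<in> B. \<exists>w\<in>R. z = p * w} = (*) p ` {w \<in> R. p * w \<in> B}" by auto
  also have "sum F \<dots> = (\<Sum>w\<in>{w \<in> R. p * w \<in> B}. F (p * w))"
    by (subst sum.reindex[OF inj]) simp
  finally show ?thesis .
qed

text \<open>
  Expanding the square and summing over \<open>w\<close> first.
\<close>

lemma bilinear_sum_square:
  fixes u :: "'k \<Rightarrow> 'w \<Rightarrow> complex"
  shows "(\<Sum>w\<in>W. (norm (\<Sum>p\<in>P. u p w))\<^sup>2) \<le> (\<Sum>p\<in>P. \<Sum>q\<in>P. norm (\<Sum>w\<in>W. u p w * cnj (u q w)))"
proof -
  have "complex_of_real (\<Sum>w\<in>W. (norm (\<Sum>p\<in>P. u p w))\<^sup>2) = (\<Sum>w\<in>W. \<Sum>p\<in>P. \<Sum>q\<in>P. u p w * cnj (u q w))"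
    by (simp only: of_real_sum complex_norm_square cnj_sum sum_product)
  also have "\<dots> = (\<Sum>p\<in>P. \<Sum>q\<in>P. \<Sum>w\<in>W. u p w * cnj (u q w))"
    by (subst sum.swap) (intro sum.cong refl sum.swap)
  finally have "norm (complex_of_real (\<Sum>w\<in>W. (norm (\<Sum>p\<in>P. u p w))\<^sup>2)) =
      norm (\<Sum>p\<in>P. \<Sum>q\<in>P. \<Sum>w\<in>W. u p w * cnj (u q w))" by simp
  also have "\<dots> \<le> (\<Sum>p\<in>P. \<Sum>q\<in>P. norm (\<Sum>w\<in>W. u p w * cnj (u q w)))"
    by (intro order.trans[OF norm_sum] sum_mono norm_sum)
  finally show ?thesis unfolding norm_of_real by linarith
qed

text \<open>
  The deterministic core of the argument, with \<open>f\<close> for the multiplicative function, \<open>g\<close> for the weight,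
  and \<open>E p w\<close> for the pairs at which multiplicativity may fail. The three terms are the costs of replacing
  \<open>A\<close> by \<open>divisor_count\<close>, of replacing \<open>f (p * w)\<close> by \<open>f p * f w\<close>, and of removing \<open>f w\<close> by the
  Cauchy--Schwarz inequality over \<open>W\<close>, which must contain every \<open>w\<close> that occurs.
\<close>

lemma katai_inequality:
  fixes f g :: "'k::field \<Rightarrow> complex" and A :: real
  assumes fin: "finite B" "finite P" "finite W" and P: "\<And>p. p \<in> P \<Longrightarrow> p \<noteq> 0 \<and> p \<in> R" and A: "A \<ge> 0"
    and B: "B \<subseteq> R" and W: "W \<subseteq> R" "\<And>p. p \<in> P \<Longrightarrow> {w \<in> R. p * w \<in> B} \<subseteq> W"
    and f: "\<And>z. z \<in> R \<Longrightarrow> norm (f z) \<le> 1" and g: "\<And>z. z \<in> R \<Longrightarrow> norm (g z) \<le> 1"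
    and mult: "\<And>p w. p \<in> P \<Longrightarrow> w \<in> R \<Longrightarrow> \<not> E p w \<Longrightarrow> f (p * w) = f p * f w"
  shows "A * norm (\<Sum>z\<in>B. f z * g z) \<le>
      sqrt (real (card B) * (\<Sum>z\<in>B. (divisor_count R P z - A)\<^sup>2))
      + 2 * (\<Sum>p\<in>P. real (card {w \<in> R. p * w \<in> B \<and> E p w}))
      + sqrt (real (card W) * ((\<Sum>(p, q)\<in>{(p, q). p \<in> P \<and> q \<in> P \<and> p \<noteq> q}.
            norm (\<Sum>w\<in>{w \<in> R. p * w \<in> B \<and> q * w \<in> B}. g (p * w) * cnj (g (q * w))))
          + (\<Sum>p\<in>P. real (card {w \<in> R. p * w \<in> B}))))"
    (is "_ \<le> ?T + 2 * ?E + sqrt (_ * (?C + ?D))")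
proof -
  define Q where "Q p = {w \<in> R. p * w \<in> B}" for p
  have Q: "Q p \<subseteq> W" "finite (Q p)" if "p \<in> P" for p
    using W(2)[OF that] fin(3) finite_subset unfolding Q_def by blast+
  define F where "F z = f z * g z" for z
  have F: "norm (F z) \<le> 1" if "z \<in> R" for z
    unfolding F_def norm_mult using f[OF that] g[OF that] by (simp add: mult_le_one)
  \<comment> \<open>extended by 0 so that the sums over \<open>w\<close> for different \<open>p\<close> have the common range \<open>W\<close>\<close>
  define u where "u p w = (if w \<in> Q p then f p * g (p * w) else 0)" for p w
  have 1: "norm (\<Sum>z\<in>B. of_real (divisor_count R P z - A) * F z) \<le> ?T"
  proof -
    have "norm (\<Sum>z\<in>B. of_real (divisor_count R P z - A) * F z) \<le> (\<Sum>z\<in>B. norm (divisor_count R P z - A))"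
    proof (intro order.trans[OF norm_sum] sum_mono)
      fix z assume "z \<in> B"
      then show "norm (of_real (divisor_count R P z - A) * F z) \<le> norm (divisor_count R P z - A)"
        unfolding norm_mult norm_of_real real_norm_def
        using F[of z] B by (intro mult_right_le_one_le) auto
    qed
    also have "\<dots> \<le> ?T" using sum_norm_le_sqrt[of "\<lambda>z. divisor_count R P z - A" B] by simp
    finally show ?thesis .
  qed
  have 2: "(\<Sum>z\<in>B. of_real (divisor_count R P z) * F z) = (\<Sum>p\<in>P. \<Sum>w\<in>Q p. F (p * w))"
  proof -
    have "(\<Sum>z\<in>B. of_real (divisor_count R P z) * F z) =
        (\<Sum>p\<in>P. \<Sum>z\<in>B. of_bool (\<exists>w\<in>R. z = p * w) * F z)"
    proof -
      have "complex_of_real (of_bool b) = of_bool b" for b by (cases b) auto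
      then show ?thesis by (subst sum.swap) (simp add: divisor_count_def sum_distrib_right)
    qed
    also have "\<dots> = (\<Sum>p\<in>P. \<Sum>w\<in>Q p. F (p * w))"
      unfolding Q_def by (rule sum.cong[OF refl], rule sum_divisible[OF fin(1)]) (use P in blast)
    finally show ?thesis .
  qed
  have 3: "norm (\<Sum>p\<in>P. \<Sum>w\<in>Q p. F (p * w) - f p * f w * g (p * w)) \<le> 2 * ?E"
  proof -
    have "norm (\<Sum>w\<in>Q p. F (p * w) - f p * f w * g (p * w)) \<le> 2 * real (card {w \<in> R. p * w \<in> B \<and> E p w})"
      if p: "p \<in> P" for p
    proof -
      have "norm (\<Sum>w\<in>Q p. F (p * w) - f p * f w * g (p * w)) \<le> (\<Sum>w\<in>Q p. if E p w then 2 else 0)"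
      proof (intro order.trans[OF norm_sum] sum_mono)
        fix w assume w: "w \<in> Q p"
        then have wR: "w \<in> R" "p * w \<in> R" using B by (auto simp: Q_def)
        have "norm (f p * f w * g (p * w)) \<le> 1"
          unfolding norm_mult using f[OF wR(1)] g[OF wR(2)] f[of p] P[OF p]
          by (intro mult_le_one) (auto intro: mult_le_one)
        then have "norm (F (p * w) - f p * f w * g (p * w)) \<le> 2"
          using F[OF wR(2)] norm_triangle_ineq4[of "F (p * w)" "f p * f w * g (p * w)"] by linarith
        then show "norm (F (p * w) - f p * f w * g (p * w)) \<le> (if E p w then 2 else 0)"
          using mult[OF p wR(1)] by (simp add: F_def)
      qed
      also have "\<dots> = 2 * real (card {w \<in> Q p. E p w})"
        using Q(2)[OF p] by (simp add: sum.inter_filter[symmetric])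
      also have "{w \<in> Q p. E p w} = {w \<in> R. p * w \<in> B \<and> E p w}" by (auto simp: Q_def)
      finally show ?thesis .
    qed
    then have "norm (\<Sum>p\<in>P. \<Sum>w\<in>Q p. F (p * w) - f p * f w * g (p * w)) \<le>
        (\<Sum>p\<in>P. 2 * real (card {w \<in> R. p * w \<in> B \<and> E p w}))"
      by (rule sum_norm_le)
    then show ?thesis by (simp add: sum_distrib_left)
  qed
  have 4: "(\<Sum>p\<in>P. \<Sum>w\<in>Q p. f p * f w * g (p * w)) = (\<Sum>w\<in>W. f w * (\<Sum>p\<in>P. u p w))"
  proof -
    have "(\<Sum>w\<in>Q p. f p * f w * g (p * w)) = (\<Sum>w\<in>W. f w * u p w)" if "p \<in> P" for p
      using Q[OF that] fin(3) by (intro sum.mono_neutral_cong_left) (auto simp: u_def)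
    then show ?thesis by (simp add: sum_distrib_left sum.swap[of _ P W])
  qed
  have 5: "norm (\<Sum>w\<in>W. f w * (\<Sum>p\<in>P. u p w)) \<le> sqrt (real (card W) * (?C + ?D))"
  proof -
    have "norm (\<Sum>w\<in>W. f w * (\<Sum>p\<in>P. u p w)) \<le> (\<Sum>w\<in>W. norm (\<Sum>p\<in>P. u p w))"
      using f W(1) by (intro order.trans[OF norm_sum] sum_mono) (auto simp: norm_mult intro!: mult_left_le_one_le)
    also have "\<dots> \<le> sqrt (real (card W) * (\<Sum>w\<in>W. (norm (\<Sum>p\<in>P. u p w))\<^sup>2))"
      by (rule sum_norm_le_sqrt)
    also have "(\<Sum>w\<in>W. (norm (\<Sum>p\<in>P. u p w))\<^sup>2) \<le> (\<Sum>p\<in>P. \<Sum>q\<in>P. norm (\<Sum>w\<in>W. u p w * cnj (u q w)))"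
      by (rule bilinear_sum_square)
    also have "\<dots> = (\<Sum>(p, q)\<in>P \<times> P. norm (\<Sum>w\<in>W. u p w * cnj (u q w)))"
      by (simp add: sum.cartesian_product)
    \<comment> \<open>the diagonal is estimated trivially, by the number of terms\<close>
    also have "P \<times> P = {(p, q). p \<in> P \<and> q \<in> P \<and> p \<noteq> q} \<union> (\<lambda>p. (p, p)) ` P" by auto
    also have "(\<Sum>(p, q)\<in>\<dots>. norm (\<Sum>w\<in>W. u p w * cnj (u q w))) =
        (\<Sum>(p, q)\<in>{(p, q). p \<in> P \<and> q \<in> P \<and> p \<noteq> q}. norm (\<Sum>w\<in>W. u p w * cnj (u q w)))
        + (\<Sum>p\<in>P. norm (\<Sum>w\<in>W. u p w * cnj (u p w)))"
    proof (subst sum.union_disjoint)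
      show "finite {(p, q). p \<in> P \<and> q \<in> P \<and> p \<noteq> q}"
        by (rule finite_subset[of _ "P \<times> P"]) (use fin in auto)
    qed (use fin in \<open>auto simp: sum.reindex inj_on_def\<close>)
    also have "\<dots> \<le> ?C + ?D"
    proof (rule add_mono; rule sum_mono)
      fix r assume "r \<in> {(p, q). p \<in> P \<and> q \<in> P \<and> p \<noteq> q}"
      then obtain p q where r: "r = (p, q)" and p: "p \<in> P" and q: "q \<in> P" by blast
      have "(\<Sum>w\<in>W. u p w * cnj (u q w)) =
          (\<Sum>w\<in>{w \<in> R. p * w \<in> B \<and> q * w \<in> B}. f p * cnj (f q) * (g (p * w) * cnj (g (q * w))))"
        using Q[OF p] Q[OF q] fin(3)
        by (intro sum.mono_neutral_cong_right) (auto simp: u_def Q_def)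
      then have "norm (\<Sum>w\<in>W. u p w * cnj (u q w)) = norm (f p * cnj (f q)) *
          norm (\<Sum>w\<in>{w \<in> R. p * w \<in> B \<and> q * w \<in> B}. g (p * w) * cnj (g (q * w)))"
        by (simp only: sum_distrib_left[symmetric] norm_mult)
      moreover have "norm (f p * cnj (f q)) \<le> 1"
        unfolding norm_mult using f P[OF p] P[OF q] by (intro mult_le_one) auto
      ultimately have "norm (\<Sum>w\<in>W. u p w * cnj (u q w)) \<le>
          norm (\<Sum>w\<in>{w \<in> R. p * w \<in> B \<and> q * w \<in> B}. g (p * w) * cnj (g (q * w)))"
        by (simp add: mult_left_le_one_le)
      then show "(case r of (p, q) \<Rightarrow> norm (\<Sum>w\<in>W. u p w * cnj (u q w))) \<le> (case r of (p, q) \<Rightarrow>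
          norm (\<Sum>w\<in>{w \<in> R. p * w \<in> B \<and> q * w \<in> B}. g (p * w) * cnj (g (q * w))))"
        by (simp add: r)
    next
      fix p assume p: "p \<in> P"
      have "norm (\<Sum>w\<in>W. u p w * cnj (u p w)) \<le> (\<Sum>w\<in>W. if w \<in> Q p then 1 else 0)"
      proof (intro order.trans[OF norm_sum] sum_mono)
        fix w assume "w \<in> W"
        show "norm (u p w * cnj (u p w)) \<le> (if w \<in> Q p then 1 else 0)"
        proof (cases "w \<in> Q p")
          case True
          then have "norm (u p w) \<le> 1" using f[of p] P[OF p] g[of "p * w"] B
            by (auto simp: u_def Q_def norm_mult intro!: mult_le_one)
          then show ?thesis using True by (simp add: norm_mult mult_le_one)
        qed (simp add: u_def)
      qed
      also have "\<dots> = real (card (W \<inter> Q p))" using fin(3) by (simp add: sum.If_cases)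
      also have "W \<inter> Q p = {w \<in> R. p * w \<in> B}" using Q(1)[OF p] by (auto simp: Q_def)
      finally show "norm (\<Sum>w\<in>W. u p w * cnj (u p w)) \<le> real (card {w \<in> R. p * w \<in> B})" .
    qed
    finally show ?thesis by (simp add: mult_left_mono)
  qed
  have eq: "of_real A * (\<Sum>z\<in>B. F z) = (\<Sum>p\<in>P. \<Sum>w\<in>Q p. F (p * w) - f p * f w * g (p * w))
      + (\<Sum>w\<in>W. f w * (\<Sum>p\<in>P. u p w)) - (\<Sum>z\<in>B. of_real (divisor_count R P z - A) * F z)"
    unfolding 4[symmetric] by (simp add: sum_subtractf algebra_simps sum_distrib_left flip: 2)
  have tri: "norm (x + y - z) \<le> norm x + norm y + norm z" for x y z :: complex
    using norm_triangle_ineq4[of "x + y" z] norm_triangle_ineq[of x y] by linarith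
  have "norm (of_real A * (\<Sum>z\<in>B. F z)) \<le> norm (\<Sum>p\<in>P. \<Sum>w\<in>Q p. F (p * w) - f p * f w * g (p * w))
      + norm (\<Sum>w\<in>W. f w * (\<Sum>p\<in>P. u p w)) + norm (\<Sum>z\<in>B. of_real (divisor_count R P z - A) * F z)"
    unfolding eq by (rule tri)
  moreover have "norm (of_real A * (\<Sum>z\<in>B. F z)) = A * norm (\<Sum>z\<in>B. f z * g z)"
    using A by (simp add: norm_mult F_def)
  ultimately show ?thesis using 1 3 5 by linarith
qed

section \<open>Arithmetic in an integral basis\<close>

definition iota :: "('d::finite \<Rightarrow> 'k::field_char_0) \<Rightarrow> int^'d \<Rightarrow> 'k" where
  "iota b n = (\<Sum>i\<in>UNIV. of_int (n $ i) * b i)"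

text \<open>
  Meaningful on the ring of integers only, which is the range of \<open>iota\<close>.
\<close>

definition coords :: "('d::finite \<Rightarrow> 'k::field_char_0) \<Rightarrow> 'k \<Rightarrow> int^'d" where
  "coords b = inv_into UNIV (iota b)"

definition int_matrix :: "('d::finite \<Rightarrow> 'k::field_char_0) \<Rightarrow> 'k \<Rightarrow> int^'d^'d" where
  "int_matrix b x = (\<chi> i. coords b (x * b i))"

text \<open>
  The field norm of an algebraic integer as an integer, where divisibility makes sense; see
  \<open>field_norm_eq\<close>.
\<close>

definition int_norm :: "('d::finite \<Rightarrow> 'k::field_char_0) \<Rightarrow> 'k \<Rightarrow> int" where
  "int_norm b x = det (int_matrix b x)"

lemma module_int_scale: "module (int_scale :: int \<Rightarrow> 'k::field_char_0 \<Rightarrow> 'k)"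
  by unfold_locales (auto simp: int_scale_def algebra_simps)

lemma iota_add: "iota b (m + n) = iota b m + iota b n"
  by (simp add: iota_def algebra_simps sum.distrib)

lemma iota_diff: "iota b (m - n) = iota b m - iota b n"
  by (simp add: iota_def algebra_simps sum_subtractf)

lemma common_denominator:
  fixes q :: "'i::finite \<Rightarrow> rat"
  obtains d :: int and n :: "'i \<Rightarrow> int" where "d \<noteq> 0" "\<And>i. of_int d * q i = of_int (n i)"
proof -
  define D where "D i = snd (quotient_of (q i))" for i
  have D: "D i \<noteq> 0" "of_int (D i) * q i = of_int (fst (quotient_of (q i)))" for i
    using quotient_of_denom_pos'[of "q i"] quotient_of_div[of "q i", OF prod.collapse[symmetric]]
    unfolding D_def by (simp, metis less_irrefl nonzero_mult_div_cancel_left of_int_eq_0_iff times_divide_eq_right)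
  have "of_int (\<Prod>j\<in>UNIV. D j) * q i = of_int ((\<Prod>j\<in>UNIV - {i}. D j) * fst (quotient_of (q i)))" for i
    using D(2)[of i] by (subst prod.remove[of _ i]) (simp_all add: ac_simps flip: D(2))
  then show ?thesis using D(1) by (intro that[of "\<Prod>j\<in>UNIV. D j" "\<lambda>i. (\<Prod>j\<in>UNIV - {i}. D j) * fst (quotient_of (q i))"]) simp_all
qed

lemma card_int_box: "card {n :: int^'d. \<forall>i. \<bar>n $ i\<bar> \<le> int m} = (2 * m + 1) ^ CARD('d)"
  and finite_int_box: "finite {n :: int^'d. \<forall>i. \<bar>n $ i\<bar> \<le> int m}"
proof -
  have bij: "bij_betw vec_nth {n :: int^'d. \<forall>i. \<bar>n $ i\<bar> \<le> int m} (UNIV \<rightarrow>\<^sub>E {- int m..int m})"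
    by (rule bij_betwI[where g = vec_lambda]) (auto simp: PiE_def Pi_def extensional_def abs_le_iff minus_le_iff[of _ "int m"])
  have "card (UNIV \<rightarrow>\<^sub>E {- int m..int m} :: ('d \<Rightarrow> int) set) = (2 * m + 1) ^ CARD('d)"
  proof -
    have "nat (2 * int m + 1) = 2 * m + 1" by simp
    then show ?thesis by (subst card_PiE) simp_all
  qed
  with bij_betw_same_card[OF bij] show "card {n :: int^'d. \<forall>i. \<bar>n $ i\<bar> \<le> int m} = (2 * m + 1) ^ CARD('d)"
    by simp
  show "finite {n :: int^'d. \<forall>i. \<bar>n $ i\<bar> \<le> int m}"
    using bij_betw_finite[OF bij] by (auto intro: finite_PiE)
qed

lemma vector_matrix_of_int:
  fixes n :: "int^'d" and A :: "int^'e^'d"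
  shows "(\<chi> i. of_int (n $ i)) v* map_matrix of_int A = (\<chi> i. of_int ((n v* A) $ i))"
  by (simp add: vector_matrix_mult_def vec_eq_iff)

lemma inj_of_int_vec: "inj (\<lambda>n::int^'d. (\<chi> i. of_int (n $ i)) :: rat^'d)"
  by (rule injI) (simp add: vec_eq_iff)

locale integral_basis_of =
  fixes b :: "'d::finite \<Rightarrow> 'k::field_char_0"
  assumes ib: "integral_basis b"
begin

abbreviation (input) "OK \<equiv> ring_of_integers :: 'k set"

lemma iota_eq_0: "iota b n = 0 \<Longrightarrow> n = 0"
proof -
  interpret m: module "int_scale :: int \<Rightarrow> 'k \<Rightarrow> 'k" by (rule module_int_scale)
  assume n: "iota b n = 0"
  have inj: "inj b" and ind: "\<not> m.dependent (range b)" using ib by (auto simp: integral_basis_def)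
  define u where "u v = n $ inv_into UNIV b v" for v
  have "(\<Sum>v\<in>range b. int_scale (u v) v) = iota b n"
    using inj by (subst sum.reindex) (auto simp: iota_def int_scale_def u_def)
  then have "u (b i) = 0" for i
    using m.independentD[OF ind, of "range b" u "b i"] n by simp
  then show "n = 0" using inj by (simp add: u_def vec_eq_iff)
qed

lemma inj_iota: "inj (iota b)"
proof (rule injI)
  fix m n assume "iota b m = iota b n"
  then have "iota b (m - n) = 0" by (simp add: iota_diff)
  from iota_eq_0[OF this] show "m = n" by simp
qed

lemma range_iota: "range (iota b) = OK"
proof -
  interpret m: module "int_scale :: int \<Rightarrow> 'k \<Rightarrow> 'k" by (rule module_int_scale)
  have inj: "inj b" and sp: "m.span (range b) = OK" using ib by (auto simp: integral_basis_def)
  have "OK = range (\<lambda>u. \<Sum>v\<in>range b. int_scale (u v) v)"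
    unfolding sp[symmetric] by (rule m.span_finite) simp
  also have "\<dots> = range (\<lambda>u. iota b (\<chi> i. u (b i)))"
    using inj by (subst sum.reindex) (auto simp: iota_def int_scale_def)
  also have "\<dots> = range (iota b)"
  proof safe
    fix n
    have "iota b n = iota b (\<chi> i. (\<lambda>v. n $ inv_into UNIV b v) (b i))"
      using inj by (simp add: vec_eq_iff)
    then show "iota b n \<in> range (\<lambda>u. iota b (\<chi> i. u (b i)))" by (intro image_eqI[of _ _ "\<lambda>v. n $ inv_into UNIV b v"]) simp_all
  qed auto
  finally show ?thesis by simp
qed

lemma coords_iota [simp]: "coords b (iota b n) = n"
  unfolding coords_def by (simp add: inj_iota)

lemma iota_coords [simp]: "z \<in> OK \<Longrightarrow> iota b (coords b z) = z"
  unfolding coords_def by (simp add: f_inv_into_f range_iota)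

lemma iota_in_OK [simp]: "iota b n \<in> OK"
  using range_iota by auto

lemma OK_add: "x \<in> OK \<Longrightarrow> y \<in> OK \<Longrightarrow> x + y \<in> OK"
  by (metis iota_add iota_coords iota_in_OK)

lemma OK_diff: "x \<in> OK \<Longrightarrow> y \<in> OK \<Longrightarrow> x - y \<in> OK"
  by (metis iota_diff iota_coords iota_in_OK)

lemma OK_mult: "x \<in> OK \<Longrightarrow> y \<in> OK \<Longrightarrow> x * y \<in> OK"
  by (simp add: ring_of_integers_def algebraic_int_mult)

lemma OK_of_int: "of_int t \<in> OK"
  by (simp add: ring_of_integers_def int_imp_algebraic_int)

lemma basis_in_OK: "b i \<in> OK"
proof -
  have "iota b (axis i 1) = b i"
    by (simp add: iota_def axis_def if_distrib[of of_int] if_distrib[of "\<lambda>x. x * _"] cong: if_cong)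
  then show ?thesis by (metis iota_in_OK)
qed

lemma coords_add: "x \<in> OK \<Longrightarrow> y \<in> OK \<Longrightarrow> coords b (x + y) = coords b x + coords b y"
  by (metis iota_add iota_coords coords_iota)

lemma coords_diff: "x \<in> OK \<Longrightarrow> y \<in> OK \<Longrightarrow> coords b (x - y) = coords b x - coords b y"
  by (metis iota_diff iota_coords coords_iota)

lemma mult_basis:
  assumes "x \<in> OK"
  shows "x * b i = (\<Sum>j\<in>UNIV. of_int (int_matrix b x $ i $ j) * b j)"
  using iota_coords[OF OK_mult[OF assms basis_in_OK[of i]]] by (simp add: int_matrix_def iota_def)

lemma iota_vector_matrix:
  assumes "x \<in> OK"
  shows "iota b (n v* int_matrix b x) = x * iota b n"
proof -
  have "x * iota b n = (\<Sum>i\<in>UNIV. of_int (n $ i) * (x * b i))"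
    by (simp add: iota_def sum_distrib_left ac_simps)
  also have "\<dots> = (\<Sum>i\<in>UNIV. \<Sum>j\<in>UNIV. of_int (n $ i * int_matrix b x $ i $ j) * b j)"
    unfolding mult_basis[OF assms] by (simp add: sum_distrib_left ac_simps)
  also have "\<dots> = iota b (n v* int_matrix b x)"
    by (subst sum.swap) (simp add: iota_def vector_matrix_mult_def sum_distrib_right)
  finally show ?thesis ..
qed

lemma coords_mult:
  assumes "x \<in> OK" "z \<in> OK"
  shows "coords b (x * z) = coords b z v* int_matrix b x"
  using iota_vector_matrix[OF assms(1), of "coords b z"] assms by (metis coords_iota iota_coords)

lemma int_matrix_mult:
  assumes "x \<in> OK" "y \<in> OK"
  shows "int_matrix b (x * y) = int_matrix b y ** int_matrix b x"
proof -
  have "int_matrix b (x * y) $ i $ j = (int_matrix b y ** int_matrix b x) $ i $ j" for i j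
  proof -
    have "int_matrix b (x * y) $ i = coords b (y * b i) v* int_matrix b x"
      using coords_mult[of x "y * b i"] assms by (simp add: int_matrix_def mult.assoc OK_mult basis_in_OK)
    then show ?thesis
      by (simp add: vector_matrix_mult_def matrix_matrix_mult_def) (simp add: int_matrix_def)
  qed
  then show ?thesis by (simp add: vec_eq_iff)
qed

lemma int_norm_mult: "x \<in> OK \<Longrightarrow> y \<in> OK \<Longrightarrow> int_norm b (x * y) = int_norm b x * int_norm b y"
  by (simp add: int_norm_def int_matrix_mult det_mul)

text \<open>
  Adding an integer to \<open>w\<close> adds a scalar matrix, so on the line \<open>w + t\<close> the norm is a monic polynomial in \<open>t\<close>.
\<close>

lemma int_norm_shift:
  assumes "w \<in> OK"
  shows "int_norm b (w + of_int t) = det (int_matrix b w + mat t)"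
proof -
  have "coords b (of_int t * b i) = (\<chi> j. if i = j then t else 0)" for i
  proof -
    have "iota b (\<chi> j. if i = j then t else 0) = of_int t * b i"
      by (simp add: iota_def if_distrib[of of_int] if_distrib[of "\<lambda>x. x * _"] cong: if_cong)
    then show ?thesis by (metis coords_iota)
  qed
  then have "int_matrix b (w + of_int t) = int_matrix b w + mat t"
    using assms by (simp add: int_matrix_def mat_def vec_eq_iff distrib_right coords_add OK_mult OK_of_int basis_in_OK)
  then show ?thesis by (simp add: int_norm_def)
qed

text \<open>
  Clearing denominators turns a rational relation into an integral one. This makes the matrix in the
  definition of \<open>mult_matrix\<close> unique.
\<close>

lemma rational_independence:
  fixes q :: "'d \<Rightarrow> rat"
  assumes "(\<Sum>i\<in>UNIV. of_rat (q i) * b i) = 0"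
  shows "q i = 0"
proof -
  obtain d n where d: "d \<noteq> 0" and n: "\<And>i. of_int d * q i = of_int (n i)"
    using common_denominator[of q] by blast
  have "of_int (n i) = (of_int d * of_rat (q i) :: 'k)" for i
    using arg_cong[OF n[of i], of "of_rat :: rat \<Rightarrow> 'k"] by (simp add: of_rat_mult)
  then have "iota b (\<chi> i. n i) = of_int d * (\<Sum>i\<in>UNIV. of_rat (q i) * b i)"
    by (simp add: iota_def sum_distrib_left ac_simps)
  with assms have "(\<chi> i. n i) = 0" using iota_eq_0 by simp
  then have "n i = 0" by (simp add: vec_eq_iff)
  with n[of i] d show ?thesis by simp
qed

lemma mult_matrix_eq:
  assumes "x \<in> OK"
  shows "mult_matrix b x = map_matrix of_int (int_matrix b x)"
  unfolding mult_matrix_def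
proof (rule the_equality)
  show "\<forall>i. x * b i = (\<Sum>j\<in>UNIV. of_rat (map_matrix of_int (int_matrix b x) $ i $ j) * b j)"
    using mult_basis[OF assms] by simp
next
  fix A :: "rat^'d^'d"
  assume A: "\<forall>i. x * b i = (\<Sum>j\<in>UNIV. of_rat (A $ i $ j) * b j)"
  have "A $ i $ j - of_int (int_matrix b x $ i $ j) = 0" for i j
  proof (rule rational_independence)
    show "(\<Sum>j\<in>UNIV. of_rat (A $ i $ j - of_int (int_matrix b x $ i $ j)) * b j) = 0"
      using A[rule_format, of i] mult_basis[OF assms, of i]
      by (simp add: of_rat_diff algebra_simps sum_subtractf)
  qed
  then show "A = map_matrix of_int (int_matrix b x)" by (simp add: vec_eq_iff)
qed

lemma field_norm_eq: "x \<in> OK \<Longrightarrow> field_norm b x = of_int (int_norm b x)"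
  by (simp add: field_norm_def mult_matrix_eq det_map_of_int int_norm_def)

lemma coprime_in_Z_iff:
  "x \<in> OK \<Longrightarrow> y \<in> OK \<Longrightarrow> coprime_in_Z (field_norm b x) (field_norm b y) \<longleftrightarrow> coprime (int_norm b x) (int_norm b y)"
  by (auto simp: coprime_in_Z_def field_norm_eq)

text \<open>
  A row vector in the kernel of the matrix of \<open>x\<close> would be the coordinate vector of an element that \<open>x\<close>
  annihilates.
\<close>

lemma int_norm_nonzero:
  assumes "x \<in> OK" "x \<noteq> 0"
  shows "int_norm b x \<noteq> 0"
proof
  assume 0: "int_norm b x = 0"
  define A :: "rat^'d^'d" where "A = map_matrix of_int (int_matrix b x)"
  have "det (transpose A) = 0" using 0 by (simp add: A_def det_transpose det_map_of_int int_norm_def)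
  then have "\<not> (\<exists>B. B ** transpose A = mat 1)"
    using invertible_det_nz[of "transpose A"] invertible_left_inverse by blast
  then obtain v where v: "v v* A = 0" "v \<noteq> 0"
    using matrix_left_invertible_ker[of "transpose A"] by auto
  have "x * (\<Sum>i\<in>UNIV. of_rat (v $ i) * b i) = (\<Sum>i\<in>UNIV. of_rat (v $ i) * (x * b i))"
    by (simp add: sum_distrib_left ac_simps)
  also have "\<dots> = (\<Sum>i\<in>UNIV. \<Sum>j\<in>UNIV. of_rat (v $ i * A $ i $ j) * b j)"
    unfolding mult_basis[OF assms(1)] by (simp add: A_def sum_distrib_left of_rat_mult ac_simps)
  also have "\<dots> = (\<Sum>j\<in>UNIV. of_rat ((v v* A) $ j) * b j)"
    by (subst sum.swap) (simp add: vector_matrix_mult_def of_rat_sum sum_distrib_right)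
  also have "\<dots> = 0" by (simp add: v)
  finally have "(\<Sum>i\<in>UNIV. of_rat (v $ i) * b i) = 0" using assms(2) by simp
  then have "v $ i = 0" for i by (rule rational_independence)
  with v(2) show False by (simp add: vec_eq_iff)
qed

text \<open>
  The norm of \<open>p\<close> lies in the ideal generated by \<open>p\<close>: Cramer's rule solves \<open>p * y = N(p) * z\<close> with
  coordinates that are determinants of integer matrices.
\<close>

lemma int_norm_multiple:
  assumes "p \<in> OK" "p \<noteq> 0" "z \<in> OK"
  obtains y where "y \<in> OK" "of_int (int_norm b p) * z = p * y"
proof -
  define A :: "rat^'d^'d" where "A = map_matrix of_int (int_matrix b p)"
  define n :: "rat^'d" where "n = (\<chi> i. of_int (coords b z $ i))"
  have dA: "det A = of_int (int_norm b p)" by (simp add: A_def det_map_of_int int_norm_def)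
  then have dA0: "det A \<noteq> 0" using int_norm_nonzero assms by simp
  define M where "M k = (\<chi> i j. if j = k then coords b z $ i else transpose (int_matrix b p) $ i $ j)" for k
  define m :: "int^'d" where "m = (\<chi> k. det (M k))"
  define x :: "rat^'d" where "x = (\<chi> k. of_int (m $ k) / det A)"
  have "x = (\<chi> k. det (\<chi> i j. if j = k then n $ i else transpose A $ i $ j) / det (transpose A))"
  proof -
    have "(\<chi> i j. if j = k then n $ i else transpose A $ i $ j) = map_matrix of_int (M k)" for k
      by (simp add: vec_eq_iff n_def A_def M_def transpose_def)
    then show ?thesis by (simp add: x_def m_def det_map_of_int det_transpose)
  qed
  then have "transpose A *v x = n" using cramer[of "transpose A" x n] dA0 by (simp add: det_transpose)
  then have xA: "x v* A = n" by simp
  have "m v* int_matrix b p = (\<chi> i. int_norm b p * coords b z $ i)"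
  proof -
    have "of_int ((m v* int_matrix b p) $ j) = (of_int (int_norm b p * coords b z $ j) :: rat)" for j
    proof -
      have "of_int ((m v* int_matrix b p) $ j) = det A * (x v* A) $ j"
        using dA0 by (simp add: vector_matrix_mult_def A_def x_def sum_distrib_left)
      then show ?thesis by (simp add: xA dA n_def)
    qed
    then show ?thesis by (simp add: vec_eq_iff flip: of_int_mult)
  qed
  then have "p * iota b m = iota b (\<chi> i. int_norm b p * coords b z $ i)"
    using iota_vector_matrix[OF assms(1), of m] by simp
  also have "\<dots> = of_int (int_norm b p) * iota b (coords b z)"
    by (simp add: iota_def sum_distrib_left ac_simps)
  finally show ?thesis using that[of "iota b m"] assms(3) by simp
qed

text \<open>
  A Bezout relation between the norms is also one between elements of the ideals of \<open>p\<close> and \<open>q\<close>,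
  so the two ideals are comaximal and their intersection is their product.
\<close>

lemma coprime_norms_common_multiple:
  assumes pq: "p \<in> OK" "p \<noteq> 0" "q \<in> OK" "q \<noteq> 0" "coprime (int_norm b p) (int_norm b q)"
    and z: "y \<in> OK" "y' \<in> OK" "z = p * y" "z = q * y'"
  obtains w where "w \<in> OK" "z = p * q * w"
proof -
  obtain s t where st: "s * int_norm b p + t * int_norm b q = 1"
    using pq(5) by (metis bezout_int coprime_imp_gcd_eq_1)
  obtain u where u: "u \<in> OK" "of_int (int_norm b p) * y' = p * u"
    using int_norm_multiple[OF pq(1,2) z(2)] by blast
  obtain v where v: "v \<in> OK" "of_int (int_norm b q) * y = q * v"
    using int_norm_multiple[OF pq(3,4) z(1)] by blast
  have "z = of_int (s * int_norm b p + t * int_norm b q) * z" by (simp add: st)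
  also have "\<dots> = of_int s * (q * (of_int (int_norm b p) * y')) + of_int t * (p * (of_int (int_norm b q) * y))"
    using z(3,4) by (simp add: algebra_simps)
  also have "\<dots> = p * q * (of_int s * u + of_int t * v)"
    unfolding u(2) v(2) by (simp add: algebra_simps)
  finally show ?thesis
    using that[of "of_int s * u + of_int t * v"] u(1) v(1) by (simp add: OK_add OK_mult OK_of_int)
qed

section \<open>Boxes\<close>

lemma lattice_embed_iota: "lattice_embed b (\<chi> i. of_int (n $ i)) = iota b n"
  by (simp add: lattice_embed_def iota_def)

lemma int_lattice_eq: "int_lattice = range (\<lambda>n::int^'d. \<chi> i. of_int (n $ i))"
proof safe
  fix n :: "rat^'d" assume "n \<in> int_lattice"
  then have "\<forall>i. \<exists>k. n $ i = of_int k" by (auto simp: int_lattice_def Ints_def)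
  then obtain k where "\<And>i. n $ i = of_int (k i)" by metis
  then have "n = (\<chi> i. of_int ((\<chi> i. k i) $ i))" by (simp add: vec_eq_iff)
  then show "n \<in> range (\<lambda>n::int^'d. \<chi> i. of_int (n $ i))" by blast
qed (auto simp: int_lattice_def)

lemma field_box_iff: "z \<in> field_box x b \<longleftrightarrow> z \<in> OK \<and> (\<forall>i. real_of_int \<bar>coords b z $ i\<bar> \<le> x)"
proof
  assume "z \<in> field_box x b"
  then obtain n :: "int^'d" where n: "z = iota b n" "(\<chi> i. of_int (n $ i)) \<in> (lattice_box x :: (rat^'d) set)"
    by (auto simp: field_box_def lattice_box_def int_lattice_eq lattice_embed_iota)
  have "\<forall>i. real_of_int \<bar>n $ i\<bar> \<le> x"
    using n(2) by (simp add: lattice_box_def flip: of_int_abs)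
  then show "z \<in> OK \<and> (\<forall>i. real_of_int \<bar>coords b z $ i\<bar> \<le> x)" by (simp add: n(1))
next
  assume z: "z \<in> OK \<and> (\<forall>i. real_of_int \<bar>coords b z $ i\<bar> \<le> x)"
  then have "(\<chi> i. of_int (coords b z $ i)) \<in> (lattice_box x :: (rat^'d) set)"
    unfolding lattice_box_def int_lattice_eq by (auto simp flip: of_int_abs)
  moreover have "z = lattice_embed b (\<chi> i. of_int (coords b z $ i))"
    using z by (simp add: lattice_embed_iota)
  ultimately show "z \<in> field_box x b" unfolding field_box_def by blast
qed

lemma field_box_eq_image:
  assumes "x \<ge> 0"
  shows "field_box x b = iota b ` {n. \<forall>i. \<bar>n $ i\<bar> \<le> int (nat \<lfloor>x\<rfloor>)}"
proof -
  have e: "(real_of_int k \<le> x) = (k \<le> int (nat \<lfloor>x\<rfloor>))" for k using assms by (simp add: le_floor_iff)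
  show ?thesis
  proof (intro equalityI subsetI)
    fix z assume "z \<in> field_box x b"
    then show "z \<in> iota b ` {n. \<forall>i. \<bar>n $ i\<bar> \<le> int (nat \<lfloor>x\<rfloor>)}"
      unfolding field_box_iff e by (intro image_eqI[of _ _ "coords b z"]) auto
  next
    fix z assume "z \<in> iota b ` {n. \<forall>i. \<bar>n $ i\<bar> \<le> int (nat \<lfloor>x\<rfloor>)}"
    then show "z \<in> field_box x b" unfolding field_box_iff e by auto
  qed
qed

lemma finite_field_box: "x \<ge> 0 \<Longrightarrow> finite (field_box x b)"
  unfolding field_box_eq_image by (intro finite_imageI finite_int_box)

lemma card_field_box:
  assumes "x \<ge> 0"
  shows "card (field_box x b) = (2 * nat \<lfloor>x\<rfloor> + 1) ^ CARD('d)"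
  unfolding field_box_eq_image[OF assms]
  by (subst card_image) (rule inj_on_subset[OF inj_iota], simp, rule card_int_box)

lemma lattice_box_iff: "(\<chi> i. of_int (n $ i)) \<in> (lattice_box x :: (rat^'d) set) \<longleftrightarrow> iota b n \<in> field_box x b"
  by (simp add: field_box_iff lattice_box_def int_lattice_eq flip: of_int_abs)

lemma twisted_sum_eq:
  "twisted_sum b f h N = (\<Sum>z\<in>field_box (real N) b. f z * h (\<chi> i. of_int (coords b z $ i)))"
proof -
  let ?u = "\<lambda>n::int^'d. (\<chi> i. of_int (n $ i)) :: rat^'d"
  let ?S = "{n. iota b n \<in> field_box (real N) b}"
  have 1: "lattice_box (real N) = ?u ` ?S"
  proof (intro equalityI subsetI)
    fix n :: "rat^'d" assume n: "n \<in> lattice_box (real N)"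
    then obtain m where "n = ?u m" by (auto simp: lattice_box_def int_lattice_eq)
    then show "n \<in> ?u ` ?S" using n lattice_box_iff by blast
  qed (use lattice_box_iff in blast)
  have 2: "field_box (real N) b = iota b ` ?S"
  proof (intro equalityI subsetI)
    fix z assume "z \<in> field_box (real N) b"
    then show "z \<in> iota b ` ?S" by (intro image_eqI[of _ _ "coords b z"]) (auto simp: field_box_iff)
  qed blast
  show ?thesis
    unfolding twisted_sum_def 1 sum.reindex[OF inj_on_subset[OF inj_of_int_vec subset_UNIV]]
    by (subst 2, subst sum.reindex[OF inj_on_subset[OF inj_iota subset_UNIV]])
       (simp add: lattice_embed_iota)
qed

lemma correlation_sum_eq:
  assumes P: "\<And>p. p \<in> P \<Longrightarrow> p \<in> OK"
  shows "correlation_sum b P h N = (\<Sum>(p, q)\<in>{(p, q). p \<in> P \<and> q \<in> P \<and> p \<noteq> q}.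
     norm (\<Sum>w\<in>{w \<in> OK. p * w \<in> field_box (real N) b \<and> q * w \<in> field_box (real N) b}.
        h (\<chi> i. of_int (coords b (p * w) $ i)) * cnj (h (\<chi> i. of_int (coords b (q * w) $ i)))))"
proof -
  let ?u = "\<lambda>n::int^'d. (\<chi> i. of_int (n $ i)) :: rat^'d"
  have "(\<Sum>n\<in>{n \<in> int_lattice. n v* mult_matrix b p \<in> lattice_box (real N) \<and>
                             n v* mult_matrix b q \<in> lattice_box (real N)}.
                h (n v* mult_matrix b p) * cnj (h (n v* mult_matrix b q)))
      = (\<Sum>w\<in>{w \<in> OK. p * w \<in> field_box (real N) b \<and> q * w \<in> field_box (real N) b}.
        h (?u (coords b (p * w))) * cnj (h (?u (coords b (q * w)))))"
    if p: "p \<in> OK" and q: "q \<in> OK" for p q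
  proof -
    let ?S = "{n. p * iota b n \<in> field_box (real N) b \<and> q * iota b n \<in> field_box (real N) b}"
    have u: "?u n v* mult_matrix b a = ?u (coords b (a * iota b n))" if "a \<in> OK" for a n
      using iota_vector_matrix[OF that, of n] coords_mult[OF that iota_in_OK[of n]] that
      by (simp add: mult_matrix_eq vector_matrix_of_int)
    have box: "?u n v* mult_matrix b a \<in> lattice_box (real N) \<longleftrightarrow> a * iota b n \<in> field_box (real N) b"
      if "a \<in> OK" for a n
      using that by (simp add: u lattice_box_iff OK_mult)
    have 1: "{n \<in> int_lattice. n v* mult_matrix b p \<in> lattice_box (real N) \<and>
                             n v* mult_matrix b q \<in> lattice_box (real N)} = ?u ` ?S"
      using box[OF p] box[OF q] by (auto simp: int_lattice_eq)
    have 2: "{w \<in> OK. p * w \<in> field_box (real N) b \<and> q * w \<in> field_box (real N) b} = iota b ` ?S"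
    proof (intro equalityI subsetI)
      fix w assume "w \<in> {w \<in> OK. p * w \<in> field_box (real N) b \<and> q * w \<in> field_box (real N) b}"
      then show "w \<in> iota b ` ?S" by (intro image_eqI[of _ _ "coords b w"]) auto
    qed auto
    show ?thesis
      unfolding 1 2 sum.reindex[OF inj_on_subset[OF inj_of_int_vec subset_UNIV]]
        sum.reindex[OF inj_on_subset[OF inj_iota subset_UNIV]]
      by (simp add: u p q)
  qed
  then show ?thesis
    unfolding correlation_sum_def using P by (intro sum.cong) auto
qed

lemma card_field_box_scaled:
  assumes "C > 0"
  shows "real (card (field_box (C * real N) b)) \<le> max 1 C ^ CARD('d) * (2 * real N + 1) ^ CARD('d)"
proof -
  have "real (nat \<lfloor>C * real N\<rfloor>) \<le> C * real N" using assms by simp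
  then have "real (2 * nat \<lfloor>C * real N\<rfloor> + 1) \<le> 2 * (C * real N) + 1" by simp
  also have "\<dots> \<le> max 1 C * (2 * real N) + max 1 C"
    using mult_right_mono[of C "max 1 C" "2 * real N"] by (simp add: ac_simps)
  finally have "real (2 * nat \<lfloor>C * real N\<rfloor> + 1) \<le> max 1 C * (2 * real N + 1)" by (simp add: distrib_left)
  then have "real (2 * nat \<lfloor>C * real N\<rfloor> + 1) ^ CARD('d) \<le> (max 1 C * (2 * real N + 1)) ^ CARD('d)"
    by (rule power_mono) simp
  then show ?thesis using assms by (simp add: card_field_box power_mult_distrib)
qed

text \<open>
  Since a nonzero norm has absolute value at least 1, the factor \<open>\<bar>N(p)\<bar> powr (- 1 / D)\<close> in the regularity
  condition can be dropped. The resulting box is the same for all \<open>p\<close>.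
\<close>

lemma regular_quotients_subset:
  assumes "regular_element C b p" "C > 0"
  shows "{w \<in> OK. p * w \<in> field_box (real N) b} \<subseteq> field_box (C * real N) b"
proof
  fix w assume w: "w \<in> {w \<in> OK. p * w \<in> field_box (real N) b}"
  have p: "p \<in> OK" "p \<noteq> 0" using assms(1) by (auto simp: regular_element_def)
  define t where "t = real_of_rat \<bar>field_norm b p\<bar> powr (- 1 / real CARD('d))"
  have "real_of_rat \<bar>field_norm b p\<bar> = \<bar>real_of_int (int_norm b p)\<bar>"
    using p by (simp add: field_norm_eq flip: of_int_abs)
  also have "\<dots> \<ge> 1" using int_norm_nonzero[OF p] by linarith
  finally have "t \<le> real_of_rat \<bar>field_norm b p\<bar> powr 0"
    unfolding t_def by (intro powr_mono) simp_all
  then have "t \<le> 1" using field_norm_eq[OF p(1)] int_norm_nonzero[OF p] by simp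
  then have le: "C * t * real N \<le> C * real N" using assms(2) by (simp add: mult_right_mono)
  have "w \<in> field_box (C * t * real N) b"
    using assms(1) w unfolding regular_element_def t_def by blast
  then show "w \<in> field_box (C * real N) b" unfolding field_box_iff using le by (meson order.trans)
qed

end

section \<open>Densities of multiples\<close>

lemma sum_inverse_squares_le:
  fixes S :: "int set"
  assumes "finite S" "\<And>l. l \<in> S \<Longrightarrow> l > 0"
  shows "(\<Sum>l\<in>S. 1 / (real_of_int l)\<^sup>2) \<le> pi\<^sup>2 / 6"
proof -
  let ?f = "\<lambda>n. 1 / (real n + 1)\<^sup>2"
  have f: "?f sums (pi\<^sup>2 / 6)" using inverse_squares_sums by (simp add: add.commute)
  have inj: "inj_on (\<lambda>l. nat l - 1) S"
  proof (rule inj_onI)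
    fix k l assume "k \<in> S" "l \<in> S" "nat k - 1 = nat l - 1"
    then show "k = l" using assms(2)[of k] assms(2)[of l] by linarith
  qed
  have "(\<Sum>l\<in>S. 1 / (real_of_int l)\<^sup>2) = (\<Sum>l\<in>S. ?f (nat l - 1))"
  proof (intro sum.cong refl)
    fix l assume "l \<in> S"
    then have "l > 0" by (rule assms)
    then have "real (nat l - 1) + 1 = real_of_int l" by (simp add: of_nat_diff)
    then show "1 / (real_of_int l)\<^sup>2 = ?f (nat l - 1)" by simp
  qed
  also have "\<dots> = sum ?f ((\<lambda>l. nat l - 1) ` S)" using inj by (simp add: sum.reindex)
  also have "\<dots> \<le> suminf ?f"
    using assms(1) sums_summable[OF f] by (intro sum_le_suminf) auto
  also have "\<dots> = pi\<^sup>2 / 6" by (rule sums_unique[OF f, symmetric])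
  finally show ?thesis .
qed

lemma box_volume_ratio: "(\<lambda>N. ((2 * real (N + c) + 1) ^ d) / (2 * real N + 1) ^ d) \<longlonglongrightarrow> 1"
proof -
  have "(\<lambda>N. (2 * real (N + c) + 1) / (2 * real N + 1)) \<longlonglongrightarrow> 1" by real_asymp
  from tendsto_power[OF this, of d] show ?thesis by (simp add: power_divide)
qed

context integral_basis_of
begin

abbreviation (input) "quotients N a \<equiv> {w \<in> OK. a * w \<in> field_box (real N) b}"

lemma finite_quotients:
  assumes "a \<noteq> 0"
  shows "finite (quotients N a)"
proof (rule inj_on_finite)
  show "inj_on ((*) a) (quotients N a)" using assms by (auto simp: inj_on_def)
  show "(*) a ` quotients N a \<subseteq> field_box (real N) b" by auto
  show "finite (field_box (real N) b)" by (rule finite_field_box) simp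
qed

text \<open>
  In coordinates, multiplication by \<open>a\<close> is the linear map of an integer matrix whose determinant is the norm.
\<close>

lemma multiples_density:
  assumes "a \<in> OK" "a \<noteq> 0"
  shows "(\<lambda>N. real (card (quotients N a)) / (2 * real N + 1) ^ CARD('d))
           \<longlonglongrightarrow> 1 / \<bar>real_of_int (int_norm b a)\<bar>"
proof -
  define A :: "real^'d^'d" where "A = map_matrix of_int (int_matrix b a)"
  have dA: "det A = real_of_int (int_norm b a)" by (simp add: A_def det_map_of_int int_norm_def)
  have "card (quotients N a) = card {w. (\<forall>i. w $ i \<in> \<int>) \<and> (\<forall>j. \<bar>(w v* A) $ j\<bar> \<le> real N)}" for N
  proof (rule bij_betw_same_card, rule bij_betw_imageI)
    let ?f = "\<lambda>w. (\<chi> i. real_of_int (coords b w $ i)) :: real^'d"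
    have vm: "(?f w v* A) $ j = real_of_int (coords b (a * w) $ j)" if "w \<in> OK" for w j
      using coords_mult[OF assms(1) that] by (simp add: vector_matrix_mult_def A_def)
    show "inj_on ?f (quotients N a)"
    proof (rule inj_onI)
      fix v w assume "v \<in> quotients N a" "w \<in> quotients N a" "?f v = ?f w"
      then have "coords b v = coords b w" "v \<in> OK" "w \<in> OK" by (simp_all add: vec_eq_iff)
      then show "v = w" by (metis iota_coords)
    qed
    show "?f ` quotients N a = {w. (\<forall>i. w $ i \<in> \<int>) \<and> (\<forall>j. \<bar>(w v* A) $ j\<bar> \<le> real N)}"
    proof (intro equalityI subsetI)
      fix x assume "x \<in> ?f ` quotients N a"
      then show "x \<in> {w. (\<forall>i. w $ i \<in> \<int>) \<and> (\<forall>j. \<bar>(w v* A) $ j\<bar> \<le> real N)}"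
        using vm by (auto simp: field_box_iff)
    next
      fix x assume x: "x \<in> {w. (\<forall>i. w $ i \<in> \<int>) \<and> (\<forall>j. \<bar>(w v* A) $ j\<bar> \<le> real N)}"
      then have "\<forall>i. \<exists>k. x $ i = of_int k" by (auto simp: Ints_def)
      then obtain k where k: "\<And>i. x $ i = of_int (k i)" by metis
      define w where "w = iota b (\<chi> i. k i)"
      have xw: "x = ?f w" by (simp add: w_def vec_eq_iff k)
      have "w \<in> OK" by (simp add: w_def)
      then have "w \<in> quotients N a" using x vm[of w] xw assms by (auto simp: field_box_iff OK_mult)
      then show "x \<in> ?f ` quotients N a" using xw by blast
    qed
  qed
  then show ?thesis using lattice_point_count[of A] dA int_norm_nonzero[OF assms] by simp
qed

text \<open>
  Double counting. Shifting each bad \<open>w\<close> by \<open>- t\<close> for \<open>0 \<le> t < l\<close> gives pairs \<open>(w - t, t)\<close>, and any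
  element occurs in at most \<open>D\<close> of them because it has at most \<open>D\<close> bad shifts. The shifts leave the box by at
  most a constant \<open>c\<close>, whence the larger box on the right, which does not affect the density.
\<close>

lemma card_norm_divisible_le:
  assumes p: "p \<in> OK" "p \<noteq> 0" and l: "prime (l :: int)"
  obtains c where "\<And>N. l * int (card {w \<in> quotients N p. l dvd int_norm b w})
                       \<le> int CARD('d) * int (card (quotients (N + c) p))"
proof -
  \<comment> \<open>bounds every coordinate of \<open>p * of_int t\<close> for \<open>0 \<le> t < l\<close>\<close>
  define c where "c = nat (l * (\<Sum>i\<in>UNIV. \<bar>coords b p $ i\<bar>))"
  have l0: "l > 0" using l prime_gt_0_int by blast
  have c: "\<bar>coords b (p * of_int t) $ i\<bar> \<le> int c" if "t \<in> {0..<l}" for t i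
  proof -
    have "p * of_int t = iota b (\<chi> i. t * coords b p $ i)"
      using iota_coords[OF p(1)] by (simp add: iota_def sum_distrib_right[symmetric] ac_simps flip: sum_distrib_left)
    then have "\<bar>coords b (p * of_int t) $ i\<bar> = \<bar>t\<bar> * \<bar>coords b p $ i\<bar>" by (simp add: abs_mult)
    also have "\<dots> \<le> l * (\<Sum>i\<in>UNIV. \<bar>coords b p $ i\<bar>)"
      using that l0 by (intro mult_mono member_le_sum) auto
    finally show ?thesis using l0 by (simp add: c_def sum_nonneg)
  qed
  show ?thesis
  proof (rule that)
    fix N
    let ?B = "{w \<in> quotients N p. l dvd int_norm b w}"
    let ?Y = "SIGMA w:quotients (N + c) p. {t \<in> {0..<l}. l dvd det (int_matrix b w + mat t)}"
    have fin: "finite {t \<in> {0..<l}. l dvd det (int_matrix b w + mat t)}" for w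
      by (rule finite_subset[of _ "{0..<l}"]) auto
    have "card (?B \<times> {0..<l}) \<le> card ?Y"
    proof (rule card_inj_on_le[where f = "\<lambda>(w, t). (w - of_int t, t)"])
      show "inj_on (\<lambda>(w, t). (w - of_int t, t)) (?B \<times> {0..<l})" by (auto simp: inj_on_def)
      show "finite ?Y" by (intro finite_SigmaI finite_quotients p fin)
      show "(\<lambda>(w, t). (w - of_int t, t)) ` (?B \<times> {0..<l}) \<subseteq> ?Y"
      proof safe
        fix w t assume w: "w \<in> OK" "p * w \<in> field_box (real N) b" "l dvd int_norm b w" and t: "t \<in> {0..<l}"
        show 1: "w - of_int t \<in> OK" using w by (simp add: OK_diff OK_of_int)
        show "l dvd det (int_matrix b (w - of_int t) + mat t)"
          using int_norm_shift[OF 1, of t] w(3) by simp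
        have pt: "p * of_int t \<in> OK" "p * w \<in> OK" using p w by (auto intro: OK_mult OK_of_int)
        show "p * (w - of_int t) \<in> field_box (real (N + c)) b"
          unfolding field_box_iff right_diff_distrib coords_diff[OF pt(2,1)]
        proof (intro conjI allI OK_diff pt)
          fix i
          have "\<bar>coords b (p * w) $ i\<bar> \<le> int N"
            using w(2) unfolding field_box_iff by (metis of_int_le_iff of_int_of_nat_eq)
          then have "\<bar>(coords b (p * w) - coords b (p * of_int t)) $ i\<bar> \<le> int (N + c)"
            using c[OF t, of i] by simp
          then show "real_of_int \<bar>(coords b (p * w) - coords b (p * of_int t)) $ i\<bar> \<le> real (N + c)"
            by (metis of_int_le_iff of_int_of_nat_eq)
        qed
      qed
    qed
    moreover have "card ?Y \<le> card (quotients (N + c) p) * CARD('d)"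
    proof -
      have "card ?Y = (\<Sum>w\<in>quotients (N + c) p. card {t \<in> {0..<l}. l dvd det (int_matrix b w + mat t)})"
        using finite_quotients[OF p(2)] fin by (intro card_SigmaI) blast+
      also have "\<dots> \<le> (\<Sum>w\<in>quotients (N + c) p. CARD('d))"
        by (intro sum_mono card_singular_shifts_le l)
      finally show ?thesis by simp
    qed
    moreover have "card (?B \<times> {0..<l}) = card ?B * nat l"
      by (simp only: card_cartesian_product card_atLeastLessThan_int diff_zero)
    ultimately have "card ?B * nat l \<le> card (quotients (N + c) p) * CARD('d)" by linarith
    then have "int (card ?B * nat l) \<le> int (card (quotients (N + c) p) * CARD('d))"
      by (simp only: of_nat_le_iff)
    then show "l * int (card ?B) \<le> int CARD('d) * int (card (quotients (N + c) p))"
      using l0 by (simp add: ac_simps)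
  qed
qed

lemma card_integer_box: "real (card (field_box (real N) b)) = (2 * real N + 1) ^ CARD('d)"
  by (simp add: card_field_box add.commute)

lemma shifted_density:
  assumes "a \<in> OK" "a \<noteq> 0"
  shows "(\<lambda>N. real (card (quotients (N + c) a)) / (2 * real N + 1) ^ CARD('d)) \<longlonglongrightarrow> 1 / \<bar>real_of_int (int_norm b a)\<bar>"
proof -
  have "(\<lambda>N. real (card (quotients (N + c) a)) / ((2 * real (N + c) + 1) ^ CARD('d))) \<longlonglongrightarrow> 1 / \<bar>real_of_int (int_norm b a)\<bar>"
    using LIMSEQ_ignore_initial_segment[OF multiples_density[OF assms], of c] .
  from tendsto_mult[OF this box_volume_ratio[of c "CARD('d)"]]
  have "(\<lambda>N. real (card (quotients (N + c) a)) / ((2 * real (N + c) + 1) ^ CARD('d)) * (((2 * real (N + c) + 1) ^ CARD('d)) / (2 * real N + 1) ^ CARD('d)))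
      \<longlonglongrightarrow> 1 / \<bar>real_of_int (int_norm b a)\<bar>" by (simp only: mult_1_right)
  moreover have "real (card (quotients (N + c) a)) / ((2 * real (N + c) + 1) ^ CARD('d)) * (((2 * real (N + c) + 1) ^ CARD('d)) / (2 * real N + 1) ^ CARD('d)) =
      real (card (quotients (N + c) a)) / (2 * real N + 1) ^ CARD('d)" for N
  proof -
    have "((2 * real (N + c) + 1) ^ CARD('d)) \<noteq> 0" by (simp add: add_nonneg_eq_0_iff)
    then show ?thesis by simp
  qed
  ultimately show ?thesis by (simp only:)
qed

text \<open>
  In the limit the events that \<open>p\<close> divides \<open>z\<close> have probability \<open>1 / \<bar>N(p)\<bar>\<close> and are pairwise independent,
  because the common multiples of \<open>p\<close> and \<open>q\<close> are the multiples of \<open>p * q\<close>. So the limit \<open>L\<close>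
  is the sum of their variances, which is at most the sum \<open>A\<close> of their probabilities.
\<close>

lemma turan_kubilius:
  assumes P: "finite P" "\<And>p. p \<in> P \<Longrightarrow> p \<in> OK \<and> p \<noteq> 0"
    and cop: "pairwise (\<lambda>p q. coprime (int_norm b p) (int_norm b q)) P"
    and A: "A = (\<Sum>p\<in>P. 1 / \<bar>real_of_int (int_norm b p)\<bar>)"
  obtains L where "L \<le> A"
    "(\<lambda>N. (\<Sum>z\<in>field_box (real N) b. (divisor_count OK P z - A)\<^sup>2) / (2 * real N + 1) ^ CARD('d)) \<longlonglongrightarrow> L"
proof -
  \<comment> \<open>the limiting probability that \<open>p\<close> divides \<open>z\<close>\<close>
  define x where "x p = 1 / \<bar>real_of_int (int_norm b p)\<bar>" for p
  define I where "I p z = (of_bool (\<exists>w\<in>OK. z = p * w) :: real)" for p z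
  \<comment> \<open>being divisible by both \<open>p\<close> and \<open>q\<close> is being divisible by \<open>m p q\<close>\<close>
  define m where "m p q = (if p = q then p else p * q)" for p q :: 'k
  have m: "m p q \<in> OK" "m p q \<noteq> 0" if "p \<in> P" "q \<in> P" for p q
    using P(2)[OF that(1)] P(2)[OF that(2)] by (auto simp: m_def OK_mult)
  have fB: "finite (field_box (real N) b)" for N by (rule finite_field_box) simp
  have cnt: "(\<Sum>z\<in>field_box (real N) b. I a z) = real (card (quotients N a))" if "a \<noteq> 0" for a N
    using sum_divisible[OF fB that, where F = "\<lambda>_. 1 :: real" and R = OK] by (simp add: I_def)
  have II: "I p z * I q z = I (m p q) z" if p: "p \<in> P" and q: "q \<in> P" for p q z
  proof (cases "p = q")
    case False
    then have cpq: "coprime (int_norm b p) (int_norm b q)"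
      using cop p q by (auto simp: pairwise_def)
    have "(\<exists>w\<in>OK. z = p * w) \<and> (\<exists>w\<in>OK. z = q * w) \<longleftrightarrow> (\<exists>w\<in>OK. z = p * q * w)"
    proof
      assume "(\<exists>w\<in>OK. z = p * w) \<and> (\<exists>w\<in>OK. z = q * w)"
      then show "\<exists>w\<in>OK. z = p * q * w"
        using coprime_norms_common_multiple[of p q _ _ z] P(2)[OF p] P(2)[OF q] cpq by metis
    next
      assume "\<exists>w\<in>OK. z = p * q * w"
      then obtain w where w: "w \<in> OK" "z = p * q * w" by blast
      then have "z = p * (q * w)" "z = q * (p * w)" by (simp_all add: ac_simps)
      then show "(\<exists>w\<in>OK. z = p * w) \<and> (\<exists>w\<in>OK. z = q * w)"
        using w(1) P(2)[OF p] P(2)[OF q] OK_mult by blast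
    qed
    then show ?thesis using False by (simp add: I_def m_def flip: of_bool_conj)
  qed (auto simp: I_def m_def)
  have expand: "(\<Sum>z\<in>field_box (real N) b. (divisor_count OK P z - A)\<^sup>2) / (2 * real N + 1) ^ CARD('d) =
      (\<Sum>p\<in>P. \<Sum>q\<in>P. real (card (quotients N (m p q))) / (2 * real N + 1) ^ CARD('d))
      - 2 * A * (\<Sum>p\<in>P. real (card (quotients N p)) / (2 * real N + 1) ^ CARD('d)) + A\<^sup>2" for N
  proof -
    let ?B = "field_box (real N) b"
    have 1: "(\<Sum>z\<in>?B. (divisor_count OK P z)\<^sup>2) = (\<Sum>p\<in>P. \<Sum>q\<in>P. real (card (quotients N (m p q))))"
    proof -
      have "(\<Sum>z\<in>?B. (divisor_count OK P z)\<^sup>2) = (\<Sum>z\<in>?B. \<Sum>p\<in>P. \<Sum>q\<in>P. I p z * I q z)"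
        by (simp add: divisor_count_def I_def power2_eq_square sum_product)
      also have "\<dots> = (\<Sum>p\<in>P. \<Sum>q\<in>P. \<Sum>z\<in>?B. I p z * I q z)"
        by (subst sum.swap) (intro sum.cong refl sum.swap)
      also have "\<dots> = (\<Sum>p\<in>P. \<Sum>q\<in>P. real (card (quotients N (m p q))))"
        by (intro sum.cong refl) (simp add: II cnt m)
      finally show ?thesis .
    qed
    have 2: "(\<Sum>z\<in>?B. divisor_count OK P z) = (\<Sum>p\<in>P. real (card (quotients N p)))"
    proof -
      have "(\<Sum>z\<in>?B. divisor_count OK P z) = (\<Sum>p\<in>P. \<Sum>z\<in>?B. I p z)"
        by (subst sum.swap) (simp add: divisor_count_def I_def)
      then show ?thesis using P(2) by (simp add: cnt)
    qed
    have "(\<Sum>z\<in>?B. (divisor_count OK P z - A)\<^sup>2) =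
        (\<Sum>z\<in>?B. (divisor_count OK P z)\<^sup>2) - 2 * A * (\<Sum>z\<in>?B. divisor_count OK P z) + A\<^sup>2 * (2 * real N + 1) ^ CARD('d)"
      unfolding card_integer_box[symmetric]
      by (simp add: power2_diff sum.distrib sum_subtractf sum_distrib_left algebra_simps)
    moreover have "(2 * real N + 1) ^ CARD('d) \<noteq> 0" by (simp add: add_nonneg_eq_0_iff)
    ultimately show ?thesis
      unfolding 1 2 by (simp add: add_divide_distrib diff_divide_distrib flip: sum_divide_distrib)
  qed
  define L where "L = (\<Sum>p\<in>P. \<Sum>q\<in>P. x (m p q)) - 2 * A * (\<Sum>p\<in>P. x p) + A\<^sup>2"
  have AX: "A = (\<Sum>p\<in>P. x p)" by (simp add: A x_def)
  show ?thesis
  proof (rule that)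
    have "x (m p q) \<le> x p * x q + (if p = q then x p else 0)" if "p \<in> P" "q \<in> P" for p q
      using P(2)[OF that(1)] P(2)[OF that(2)] by (auto simp: m_def x_def int_norm_mult abs_mult)
    then have "(\<Sum>p\<in>P. \<Sum>q\<in>P. x (m p q)) \<le> (\<Sum>p\<in>P. \<Sum>q\<in>P. x p * x q + (if p = q then x p else 0))"
      by (intro sum_mono)
    also have "\<dots> = A\<^sup>2 + A"
      using P(1) by (simp add: sum.distrib AX power2_eq_square sum_product)
    finally show "L \<le> A" unfolding L_def AX[symmetric] by (simp add: power2_eq_square)
    show "(\<lambda>N. (\<Sum>z\<in>field_box (real N) b. (divisor_count OK P z - A)\<^sup>2) / (2 * real N + 1) ^ CARD('d)) \<longlonglongrightarrow> L"
      unfolding expand L_def x_def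
      by (intro tendsto_intros multiples_density m) (use P(2) in auto)
  qed
qed

text \<open>
  A union bound over the rational primes \<open>l\<close> dividing the norm of \<open>p\<close>. The limit is
  \<open>D * (\<Sum>p. \<Sum>l. 1 / (l * \<bar>N(p)\<bar>))\<close>. Here \<open>\<bar>N(p)\<bar> \<ge> l\<close>, and no \<open>l\<close> occurs for two different \<open>p\<close>, so
  the sum over the reciprocal squares of all positive integers bounds it independently of \<open>P\<close>.
\<close>

lemma noncoprime_quotients_density:
  assumes P: "finite P" "\<And>p. p \<in> P \<Longrightarrow> p \<in> OK \<and> p \<noteq> 0"
    and cop: "pairwise (\<lambda>p q. coprime (int_norm b p) (int_norm b q)) P"
  obtains U L where "U \<longlonglongrightarrow> L" "0 \<le> L" "L \<le> real CARD('d) * (pi\<^sup>2 / 6)"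
    "\<And>N. (\<Sum>p\<in>P. real (card {w \<in> OK. p * w \<in> field_box (real N) b \<and>
              \<not> coprime (int_norm b p) (int_norm b w)})) / (2 * real N + 1) ^ CARD('d) \<le> U N"
proof -
  define PF where "PF p = prime_factors (int_norm b p)" for p
  have PF: "prime l" "l dvd int_norm b p" "l > 0" if "l \<in> PF p" for l p
    using that prime_gt_0_int by (auto simp: PF_def)
  define c where "c p l = (SOME c. \<forall>N. l * int (card {w \<in> quotients N p. l dvd int_norm b w})
                       \<le> int CARD('d) * int (card (quotients (N + c) p)))" for p l
  have c: "l * int (card {w \<in> quotients N p. l dvd int_norm b w}) \<le> int CARD('d) * int (card (quotients (N + c p l) p))"
    if p: "p \<in> P" and l: "l \<in> PF p" for p l N
  proof -
    obtain c' where "\<And>N. l * int (card {w \<in> quotients N p. l dvd int_norm b w})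
                       \<le> int CARD('d) * int (card (quotients (N + c') p))"
      using card_norm_divisible_le[of p l] P(2)[OF p] PF(1)[OF l] by blast
    then have "\<exists>c. \<forall>N. l * int (card {w \<in> quotients N p. l dvd int_norm b w})
                       \<le> int CARD('d) * int (card (quotients (N + c) p))" by blast
    from someI_ex[OF this] show ?thesis unfolding c_def by blast
  qed
  define U where "U N = (\<Sum>p\<in>P. \<Sum>l\<in>PF p. real CARD('d) / l * (card (quotients (N + c p l) p) / (2 * real N + 1) ^ CARD('d)))" for N
  define L where "L = (\<Sum>p\<in>P. \<Sum>l\<in>PF p. real CARD('d) / l * (1 / \<bar>real_of_int (int_norm b p)\<bar>))"
  show ?thesis
  proof (rule that)
    show "U \<longlonglongrightarrow> L"
      unfolding U_def L_def using P(2) by (intro tendsto_intros shifted_density) auto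
    show "0 \<le> L"
      unfolding L_def by (intro sum_nonneg) (auto simp: PF less_imp_le)
    show "L \<le> real CARD('d) * (pi\<^sup>2 / 6)"
    proof -
      have "real CARD('d) / l * (1 / \<bar>real_of_int (int_norm b p)\<bar>) \<le> real CARD('d) * (1 / (real_of_int l)\<^sup>2)"
        if "p \<in> P" "l \<in> PF p" for p l
      proof -
        have "\<bar>int_norm b p\<bar> \<ge> l"
          using dvd_imp_le_int[OF _ PF(2)[OF that(2)]] int_norm_nonzero P(2)[OF that(1)] by auto
        then have "\<bar>real_of_int (int_norm b p)\<bar> \<ge> l" by linarith
        then have "1 / \<bar>real_of_int (int_norm b p)\<bar> \<le> 1 / real_of_int l"
          using PF(3)[OF that(2)] by (intro divide_left_mono) auto
        then have "real CARD('d) / l * (1 / \<bar>real_of_int (int_norm b p)\<bar>) \<le> real CARD('d) / l * (1 / real_of_int l)"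
          using PF(3)[OF that(2)] by (intro mult_left_mono) auto
        then show ?thesis by (simp add: power2_eq_square)
      qed
      then have "L \<le> (\<Sum>p\<in>P. \<Sum>l\<in>PF p. real CARD('d) * (1 / (real_of_int l)\<^sup>2))"
        unfolding L_def by (intro sum_mono)
      also have "\<dots> = real CARD('d) * (\<Sum>p\<in>P. \<Sum>l\<in>PF p. 1 / (real_of_int l)\<^sup>2)"
        by (simp only: sum_distrib_left)
      also have "(\<Sum>p\<in>P. \<Sum>l\<in>PF p. 1 / (real_of_int l)\<^sup>2) = (\<Sum>l\<in>(\<Union>p\<in>P. PF p). 1 / (real_of_int l)\<^sup>2)"
      proof (rule sum.UNION_disjoint[symmetric])
        show "\<forall>p\<in>P. \<forall>q\<in>P. p \<noteq> q \<longrightarrow> PF p \<inter> PF q = {}"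
        proof (intro ballI impI)
          fix p q assume "p \<in> P" "q \<in> P" "p \<noteq> q"
          then have "coprime (int_norm b p) (int_norm b q)" using cop by (auto simp: pairwise_def)
          then show "PF p \<inter> PF q = {}"
            using PF(1,2) by (auto simp: disjoint_iff) (metis coprime_common_divisor not_prime_unit)
        qed
      qed (use P in \<open>auto simp: PF_def\<close>)
      also have "\<dots> \<le> pi\<^sup>2 / 6"
        using P(1) by (intro sum_inverse_squares_le) (auto simp: PF, simp add: PF_def)
      finally show ?thesis by (simp add: mult_left_mono)
    qed
    fix N
    have "real (card {w \<in> OK. p * w \<in> field_box (real N) b \<and> \<not> coprime (int_norm b p) (int_norm b w)}) \<le>
        (\<Sum>l\<in>PF p. real CARD('d) / l * card (quotients (N + c p l) p))" if p: "p \<in> P" for p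
    proof -
      let ?E = "\<lambda>l. {w \<in> quotients N p. l dvd int_norm b w}"
      have p0: "p \<noteq> 0" "int_norm b p \<noteq> 0" using P(2)[OF p] int_norm_nonzero by auto
      have fE: "finite (?E l)" for l by (rule finite_subset[OF _ finite_quotients[OF p0(1), of N]]) auto
      have "{w \<in> OK. p * w \<in> field_box (real N) b \<and> \<not> coprime (int_norm b p) (int_norm b w)} \<subseteq> (\<Union>l\<in>PF p. ?E l)"
      proof safe
        fix w assume w: "w \<in> OK" "p * w \<in> field_box (real N) b" "\<not> coprime (int_norm b p) (int_norm b w)"
        then obtain l where l: "prime l" "l dvd gcd (int_norm b p) (int_norm b w)"
          using p0(2) prime_divisor_exists[of "gcd (int_norm b p) (int_norm b w)"]
          by (auto simp: coprime_iff_gcd_eq_1 is_unit_gcd)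
        then have "l \<in> PF p" using p0(2) by (auto simp: PF_def prime_factors_dvd)
        then show "w \<in> (\<Union>l\<in>PF p. ?E l)" using w l by auto
      qed
      then have "card {w \<in> OK. p * w \<in> field_box (real N) b \<and> \<not> coprime (int_norm b p) (int_norm b w)} \<le> card (\<Union>l\<in>PF p. ?E l)"
        using fE by (intro card_mono) (auto simp: PF_def)
      also have "\<dots> \<le> (\<Sum>l\<in>PF p. card (?E l))" by (rule card_UN_le) (simp add: PF_def)
      finally have "real (card {w \<in> OK. p * w \<in> field_box (real N) b \<and> \<not> coprime (int_norm b p) (int_norm b w)})
          \<le> (\<Sum>l\<in>PF p. real (card (?E l)))" unfolding of_nat_sum[symmetric] of_nat_le_iff .
      also have "\<dots> \<le> (\<Sum>l\<in>PF p. real CARD('d) / l * card (quotients (N + c p l) p))"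
      proof (rule sum_mono)
        fix l assume l: "l \<in> PF p"
        have "real_of_int (l * int (card (?E l))) \<le> real_of_int (int CARD('d) * int (card (quotients (N + c p l) p)))"
          using c[OF p l, of N] by (simp only: of_int_le_iff)
        then show "real (card (?E l)) \<le> real CARD('d) / l * card (quotients (N + c p l) p)"
          using PF(3)[OF l] by (simp add: field_simps)
      qed
      finally show ?thesis .
    qed
    then have "(\<Sum>p\<in>P. real (card {w \<in> OK. p * w \<in> field_box (real N) b \<and> \<not> coprime (int_norm b p) (int_norm b w)})) \<le>
       (\<Sum>p\<in>P. \<Sum>l\<in>PF p. real CARD('d) / l * card (quotients (N + c p l) p))" by (rule sum_mono)
    from divide_right_mono[OF this, of "(2 * real N + 1) ^ CARD('d)"]
    show "(\<Sum>p\<in>P. real (card {w \<in> OK. p * w \<in> field_box (real N) b \<and> \<not> coprime (int_norm b p) (int_norm b w)}))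
        / (2 * real N + 1) ^ CARD('d) \<le> U N"
      unfolding U_def by (simp add: sum_divide_distrib)
  qed
qed

end

section \<open>Assembling the estimate\<close>

lemma square_sum3_le: "((x::real) + y + z)\<^sup>2 \<le> 3 * (x\<^sup>2 + y\<^sup>2 + z\<^sup>2)"
proof -
  have "0 \<le> (x - y)\<^sup>2 + (y - z)\<^sup>2 + (x - z)\<^sup>2" by simp
  then show ?thesis by (simp add: power2_eq_square algebra_simps)
qed

context integral_basis_of
begin

text \<open>
  Dividing \<open>katai_inequality\<close> by the volume of the box and squaring, with \<open>(x + y + z)\<^sup>2 \<le> 3 (x\<^sup>2 + y\<^sup>2 + z\<^sup>2)\<close>,
  bounds \<open>A\<^sup>2 \<bar>S(N)\<bar>\<^sup>2\<close> by averages whose limits are at most \<open>A\<close>, \<open>K\<^sup>2\<close> and \<open>A\<close>. The excess of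
  each average over its bound, cut off at 0, goes into \<open>\<rho>\<close>. The power of \<open>max 1 C\<close> compares the box
  that contains all \<open>w\<close> with the box of side \<open>N\<close>; \<open>K\<close> bounds the density of the pairs at which
  multiplicativity fails.
\<close>

lemma katai_bound:
  assumes C: "C > 0" and P: "finite P" "P \<noteq> {}" "\<And>p. p \<in> P \<Longrightarrow> regular_element C b p"
    and cop: "pairwise (\<lambda>p q. coprime_in_Z (field_norm b p) (field_norm b q)) P"
    and K: "K = real CARD('d) * (pi\<^sup>2 / 6)"
    and C1: "C1 = 3 * (1 + max 1 C ^ CARD('d) + 4 * K\<^sup>2)"
  obtains \<rho> :: "nat \<Rightarrow> real" where "\<And>N. \<rho> N \<ge> 0" "\<rho> \<longlonglongrightarrow> 0"
    "\<And>f h N. f \<in> multiplicative_funs b \<Longrightarrow> (\<forall>n\<in>int_lattice. norm (h n) \<le> 1) \<Longrightarrow>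
       (norm (twisted_sum b f h N / (2 * of_nat N + 1) ^ CARD('d)))\<^sup>2
               \<le> C1 * (1 / (inverse_norm_sum b P)\<^sup>2
                         * (correlation_sum b P h N / (2 * real N + 1) ^ CARD('d))
                       + 1 / inverse_norm_sum b P + 1 / (inverse_norm_sum b P)\<^sup>2)
                 + \<rho> N"
proof -
  have PO: "p \<in> OK \<and> p \<noteq> 0" if "p \<in> P" for p
    using P(3)[OF that] by (auto simp: regular_element_def)
  have cop': "pairwise (\<lambda>p q. coprime (int_norm b p) (int_norm b q)) P"
    using cop PO by (auto simp: pairwise_def coprime_in_Z_iff)
  define A where "A = inverse_norm_sum b P"
  have A: "A = (\<Sum>p\<in>P. 1 / \<bar>real_of_int (int_norm b p)\<bar>)"
    unfolding A_def inverse_norm_sum_def using PO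
    by (intro sum.cong refl) (simp add: field_norm_eq flip: of_int_abs)
  have A0: "A > 0"
    unfolding A using P(1,2) PO int_norm_nonzero by (intro sum_pos) auto
  define D where "D = max 1 C ^ CARD('d)"
  have D: "D \<ge> 1" unfolding D_def by (rule one_le_power) simp
  define V where "V N = (2 * real N + 1) ^ CARD('d)" for N :: nat
  have V: "V N > 0" for N unfolding V_def by (intro zero_less_power) linarith
  define T where "T N = (\<Sum>z\<in>field_box (real N) b. (divisor_count OK P z - A)\<^sup>2) / V N" for N
  define G where "G N = (\<Sum>p\<in>P. real (card (quotients N p))) / V N" for N
  obtain L where L: "L \<le> A" "T \<longlonglongrightarrow> L"
    using turan_kubilius[OF P(1) PO cop' A] unfolding T_def V_def by blast
  obtain U M where U: "U \<longlonglongrightarrow> M" "0 \<le> M" "M \<le> K"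
    "\<And>N. (\<Sum>p\<in>P. real (card {w \<in> OK. p * w \<in> field_box (real N) b \<and>
              \<not> coprime (int_norm b p) (int_norm b w)})) / V N \<le> U N"
    using noncoprime_quotients_density[OF P(1) PO cop'] unfolding K V_def by blast
  have G: "G \<longlonglongrightarrow> A"
    unfolding G_def V_def A sum_divide_distrib
    by (intro tendsto_sum multiples_density) (use PO in auto)
  define \<rho> where "\<rho> N = 3 / A\<^sup>2 * (max 0 (T N - A) + 4 * max 0 ((U N)\<^sup>2 - K\<^sup>2) + D * max 0 (G N - A))" for N
  show ?thesis
  proof (rule that)
    show "\<rho> N \<ge> 0" for N unfolding \<rho>_def using D by (intro mult_nonneg_nonneg add_nonneg_nonneg) auto
    have "\<rho> \<longlonglongrightarrow> 3 / A\<^sup>2 * (max 0 (L - A) + 4 * max 0 (M\<^sup>2 - K\<^sup>2) + D * max 0 (A - A))"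
      unfolding \<rho>_def by (intro tendsto_intros L U G)
    moreover have "M\<^sup>2 \<le> K\<^sup>2" using U(2,3) by (intro power_mono)
    ultimately show "\<rho> \<longlonglongrightarrow> 0" using L(1) by simp
  next
    fix f :: "'k \<Rightarrow> complex" and h :: "rat^'d \<Rightarrow> complex" and N :: nat
    assume f: "f \<in> multiplicative_funs b" and h: "\<forall>n\<in>int_lattice. norm (h n) \<le> 1"
    define g where "g z = h (\<chi> i. of_int (coords b z $ i))" for z
    define S where "S = (\<Sum>z\<in>field_box (real N) b. f z * g z)"
    define R where "R = correlation_sum b P h N"
    define E where "E = (\<Sum>p\<in>P. real (card {w \<in> OK. p * w \<in> field_box (real N) b \<and>
              \<not> coprime (int_norm b p) (int_norm b w)}))"
    have R: "R = (\<Sum>(p, q)\<in>{(p, q). p \<in> P \<and> q \<in> P \<and> p \<noteq> q}.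
     norm (\<Sum>w\<in>{w \<in> OK. p * w \<in> field_box (real N) b \<and> q * w \<in> field_box (real N) b}.
        g (p * w) * cnj (g (q * w))))"
      unfolding R_def g_def using PO by (intro correlation_sum_eq) blast
    have R0: "R \<ge> 0" unfolding R by (intro sum_nonneg) auto
    have G0: "G N \<ge> 0" unfolding G_def using V[of N] by (intro divide_nonneg_pos sum_nonneg) auto
    have g1: "norm (g z) \<le> 1" for z
      unfolding g_def using h by (auto simp: int_lattice_eq)
    have "A * norm S \<le> sqrt (real (card (field_box (real N) b)) * (T N * V N)) + 2 * E
        + sqrt (real (card (field_box (C * real N) b)) * (R + G N * V N))"
    proof -
      have "A * norm S \<le> sqrt (real (card (field_box (real N) b)) *
            (\<Sum>z\<in>field_box (real N) b. (divisor_count OK P z - A)\<^sup>2)) + 2 * E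
          + sqrt (real (card (field_box (C * real N) b)) * (R + (\<Sum>p\<in>P. real (card (quotients N p)))))"
        unfolding S_def E_def R
      proof (rule katai_inequality)
        show "finite (field_box (real N) b)" "finite (field_box (C * real N) b)"
          using C by (auto intro: finite_field_box)
        show "field_box (real N) b \<subseteq> OK" "field_box (C * real N) b \<subseteq> OK"
          by (auto simp: field_box_iff)
        show "f (p * w) = f p * f w"
          if "p \<in> P" "w \<in> OK" "\<not> \<not> coprime (int_norm b p) (int_norm b w)" for p w
          using f that PO[OF that(1)] by (auto simp: multiplicative_funs_def coprime_in_Z_iff)
        show "{w \<in> OK. p * w \<in> field_box (real N) b} \<subseteq> field_box (C * real N) b" if "p \<in> P" for p
          using regular_quotients_subset[OF P(3)[OF that] C] .
      qed (use P(1) PO A0 f g1 in \<open>auto simp: multiplicative_funs_def\<close>)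
      then show ?thesis using V[of N] by (simp add: T_def G_def)
    qed
    also have "\<dots> \<le> V N * sqrt (T N) + 2 * (V N * U N) + V N * sqrt (D * (R / V N + G N))"
    proof (intro add_mono)
      have VV: "V N * sqrt x = sqrt (V N * (x * V N))" for x
        using V[of N] by (simp add: real_sqrt_mult)
      show "sqrt (real (card (field_box (real N) b)) * (T N * V N)) \<le> V N * sqrt (T N)"
        unfolding VV card_integer_box V_def[symmetric] by simp
      show "2 * E \<le> 2 * (V N * U N)"
        using U(4)[of N] V[of N] by (simp add: E_def field_simps)
      have "real (card (field_box (C * real N) b)) * (R + G N * V N) \<le> (D * V N) * (R + G N * V N)"
        using card_field_box_scaled[OF C, of N] R0 G0 V[of N]
        by (intro mult_right_mono) (auto simp: D_def V_def)
      also have "\<dots> = V N * (D * (R / V N + G N) * V N)"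
        using V[of N] by (simp add: field_simps)
      finally show "sqrt (real (card (field_box (C * real N) b)) * (R + G N * V N)) \<le> V N * sqrt (D * (R / V N + G N))"
        unfolding VV by simp
    qed
    also have "\<dots> = V N * (sqrt (T N) + 2 * U N + sqrt (D * (R / V N + G N)))"
      by (simp add: algebra_simps)
    finally have "A * (norm S / V N) \<le> sqrt (T N) + 2 * U N + sqrt (D * (R / V N + G N))"
      using V[of N] by (simp add: field_simps)
    then have "(A * (norm S / V N))\<^sup>2 \<le> (sqrt (T N) + 2 * U N + sqrt (D * (R / V N + G N)))\<^sup>2"
      using A0 V[of N] by (intro power_mono) auto
    also have "\<dots> \<le> 3 * ((sqrt (T N))\<^sup>2 + (2 * U N)\<^sup>2 + (sqrt (D * (R / V N + G N)))\<^sup>2)"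
      by (rule square_sum3_le)
    also have "\<dots> = 3 * (T N + 4 * (U N)\<^sup>2 + D * (R / V N + G N))"
    proof -
      have "T N \<ge> 0" unfolding T_def using V[of N] by (intro divide_nonneg_pos sum_nonneg) auto
      moreover have "D * (R / V N + G N) \<ge> 0" using D R0 G0 V[of N] by simp
      ultimately show ?thesis by (simp add: power_mult_distrib)
    qed
    also have "\<dots> \<le> 3 * ((A + max 0 (T N - A)) + 4 * (K\<^sup>2 + max 0 ((U N)\<^sup>2 - K\<^sup>2))
        + D * (R / V N + (A + max 0 (G N - A))))"
      using D by (intro mult_left_mono add_mono) auto
    finally have "(norm S / V N)\<^sup>2 * A\<^sup>2 \<le> 3 * ((A + max 0 (T N - A)) + 4 * (K\<^sup>2 + max 0 ((U N)\<^sup>2 - K\<^sup>2))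
        + D * (R / V N + (A + max 0 (G N - A))))"
      by (simp only: power_mult_distrib[of A] mult.commute[of "A\<^sup>2"])
    then have "(norm S / V N)\<^sup>2 \<le> 3 * ((A + max 0 (T N - A)) + 4 * (K\<^sup>2 + max 0 ((U N)\<^sup>2 - K\<^sup>2))
        + D * (R / V N + (A + max 0 (G N - A)))) / A\<^sup>2"
      using A0 by (intro pos_le_divide_eq[THEN iffD2]) simp_all
    also have "\<dots> = 3 * (D * (1 / A\<^sup>2 * (R / V N)) + (1 + D) * (1 / A) + 4 * K\<^sup>2 * (1 / A\<^sup>2)) + \<rho> N"
      using A0 by (simp add: \<rho>_def field_simps power2_eq_square)
    also have "\<dots> \<le> C1 * (1 / A\<^sup>2 * (R / V N) + 1 / A + 1 / A\<^sup>2) + \<rho> N"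
    proof -
      have "D * (1 / A\<^sup>2 * (R / V N)) \<le> (1 + D + 4 * K\<^sup>2) * (1 / A\<^sup>2 * (R / V N))"
        using R0 V[of N] by (intro mult_right_mono) auto
      moreover have "(1 + D) * (1 / A) \<le> (1 + D + 4 * K\<^sup>2) * (1 / A)"
        using A0 by (intro mult_right_mono) auto
      moreover have "4 * K\<^sup>2 * (1 / A\<^sup>2) \<le> (1 + D + 4 * K\<^sup>2) * (1 / A\<^sup>2)"
        using D by (intro mult_right_mono) auto
      ultimately have "D * (1 / A\<^sup>2 * (R / V N)) + (1 + D) * (1 / A) + 4 * K\<^sup>2 * (1 / A\<^sup>2) \<le>
          (1 + D + 4 * K\<^sup>2) * (1 / A\<^sup>2 * (R / V N) + 1 / A + 1 / A\<^sup>2)"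
        unfolding distrib_left[of "1 + D + 4 * K\<^sup>2"] by (intro add_mono)
      then show ?thesis unfolding C1 D_def[symmetric] mult.assoc[of 3]
        by (intro add_right_mono mult_left_mono) simp_all
    qed
    finally have "(norm S / V N)\<^sup>2 \<le> C1 * (1 / A\<^sup>2 * (R / V N) + 1 / A + 1 / A\<^sup>2) + \<rho> N" .
    moreover have "norm (twisted_sum b f h N / (2 * of_nat N + 1) ^ CARD('d)) = norm S / V N"
    proof -
      have "(2 * of_nat N + 1 :: complex) ^ CARD('d) = of_real (V N)" by (simp add: V_def)
      then show ?thesis
        using V[of N] by (simp only: twisted_sum_eq norm_divide norm_of_real S_def g_def abs_of_pos)
    qed
    ultimately show "(norm (twisted_sum b f h N / (2 * of_nat N + 1) ^ CARD('d)))\<^sup>2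
               \<le> C1 * (1 / (inverse_norm_sum b P)\<^sup>2
                         * (correlation_sum b P h N / (2 * real N + 1) ^ CARD('d))
                       + 1 / inverse_norm_sum b P + 1 / (inverse_norm_sum b P)\<^sup>2)
                 + \<rho> N"
      by (simp only: A_def R_def V_def)
  qed
qed

end

theorem lemma2p21:
  fixes b :: "'d::finite \<Rightarrow> 'k::field_char_0" and C :: real
  assumes "number_field TYPE('k)"
    and "CARD('d) = field_degree TYPE('k)"
    and "integral_basis b"
    and "C > 0"
  shows "\<exists>C1::real. C1 > 0 \<and>
    (\<forall>P :: 'k set.
       finite P \<and> P \<noteq> {} \<and> (\<forall>p\<in>P. prime_elt p \<and> regular_element C b p) \<and>
       pairwise (\<lambda>p q. coprime_in_Z (field_norm b p) (field_norm b q)) P \<longrightarrow>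
       (\<exists>\<rho> :: nat \<Rightarrow> real. (\<forall>N. \<rho> N \<ge> 0) \<and> \<rho> \<longlonglongrightarrow> 0 \<and>
          (\<forall>f \<in> multiplicative_funs b. \<forall>h :: rat^'d \<Rightarrow> complex. \<forall>N :: nat.
             (\<forall>n\<in>int_lattice. norm (h n) \<le> 1) \<longrightarrow>
             (norm (twisted_sum b f h N / (2 * of_nat N + 1) ^ CARD('d)))\<^sup>2
               \<le> C1 * (1 / (inverse_norm_sum b P)\<^sup>2
                         * (correlation_sum b P h N / (2 * real N + 1) ^ CARD('d))
                       + 1 / inverse_norm_sum b P + 1 / (inverse_norm_sum b P)\<^sup>2)
                 + \<rho> N)))"
proof -
  interpret integral_basis_of b by unfold_locales (rule assms(3))
  define K where "K = real CARD('d) * (pi\<^sup>2 / 6)"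
  define C1 where "C1 = 3 * (1 + max 1 C ^ CARD('d) + 4 * K\<^sup>2)"
  have "C1 > 0"
  proof -
    have "max 1 C ^ CARD('d) > 0" by (intro zero_less_power) linarith
    then show ?thesis unfolding C1_def by (intro mult_pos_pos add_pos_nonneg) auto
  qed
  moreover have "\<exists>\<rho> :: nat \<Rightarrow> real. (\<forall>N. \<rho> N \<ge> 0) \<and> \<rho> \<longlonglongrightarrow> 0 \<and>
          (\<forall>f \<in> multiplicative_funs b. \<forall>h :: rat^'d \<Rightarrow> complex. \<forall>N :: nat.
             (\<forall>n\<in>int_lattice. norm (h n) \<le> 1) \<longrightarrow>
             (norm (twisted_sum b f h N / (2 * of_nat N + 1) ^ CARD('d)))\<^sup>2
               \<le> C1 * (1 / (inverse_norm_sum b P)\<^sup>2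
                         * (correlation_sum b P h N / (2 * real N + 1) ^ CARD('d))
                       + 1 / inverse_norm_sum b P + 1 / (inverse_norm_sum b P)\<^sup>2)
                 + \<rho> N)"
    if P: "finite P \<and> P \<noteq> {} \<and> (\<forall>p\<in>P. prime_elt p \<and> regular_element C b p) \<and>
       pairwise (\<lambda>p q. coprime_in_Z (field_norm b p) (field_norm b q)) P" for P
  proof -
    have P': "finite P" "P \<noteq> {}" "\<And>p. p \<in> P \<Longrightarrow> regular_element C b p"
      "pairwise (\<lambda>p q. coprime_in_Z (field_norm b p) (field_norm b q)) P" using P by auto
    obtain \<rho> where \<rho>: "\<And>N. \<rho> N \<ge> 0" "\<rho> \<longlonglongrightarrow> 0"
      "\<And>f h N. f \<in> multiplicative_funs b \<Longrightarrow> (\<forall>n\<in>int_lattice. norm (h n) \<le> 1) \<Longrightarrow>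
       (norm (twisted_sum b f h N / (2 * of_nat N + 1) ^ CARD('d)))\<^sup>2
               \<le> C1 * (1 / (inverse_norm_sum b P)\<^sup>2
                         * (correlation_sum b P h N / (2 * real N + 1) ^ CARD('d))
                       + 1 / inverse_norm_sum b P + 1 / (inverse_norm_sum b P)\<^sup>2)
                 + \<rho> N"
      using katai_bound[OF assms(4) P' K_def C1_def] by blast
    show ?thesis
      by (rule exI[of _ \<rho>], intro conjI allI ballI impI) (fact \<rho>(1), fact \<rho>(2), rule \<rho>(3))
  qed
  ultimately show ?thesis by blast
qed

end
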